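(* Let $d\ge 1$ and $k\ge 1$ be fixed integers. For each $n$, let $\mathcal X_n$ be a set of $n$ points sampled independently and uniformly from the unit cube $[-\tfrac12,\tfrac12]^d$, indexed by ascending distance to the origin. Let $\mathrm{VR}(\mathcal X_n)$ be the (complete) Vietoris--Rips filtration on $\mathcal X_n$ with its simplices ordered $\rho$-lexicographically, let $D$ be its $k$-dimensional boundary matrix and let $D'$ be the reduced matrix obtained from $D$ by matrix reduction. Then, as $n\to\infty$, $$\mathbb E[\# D']=\mathcal O\big(n^{2}(\log n)^{2k}+n^{k+1}\big),$$ and the expected cost of the matrix reduction satisfies $$\mathbb E[\mathrm{cost}(D)]=\mathcal O\big(n^{k+4}(\log n)^{2k}+n^{2k+3}\big).$$
   Context: **Matrix reduction.** Matrices have entries in $\mathbb Z_2$. For a non-zero column $M_i$, its pivot $low(M_i)$ is the index of the lowest row (i.e. the largest row index) with a non-zero entry. $\#M_i$ is the number of non-zero entries of column $M_i$, and $\#M=\sum_i\#M_i$. Matrix reduction of $M=(M_1,\dots,M_c)$ is the following algorithm: for $i=1,\dots,c$ in order, set $M'_i:=M_i$; while $M'_i\ne 0$ and there is $j<i$ with $low(M'_j)=low(M'_i)$, replace $M'_i$ by $M'_i+M'_j$. The output $M'=(M'_1,\dots,M'_c)$ is the reduced matrix and $\#M'$ is called the fill-in. The cost of one addition $M'_i\leftarrow M'_i+M'_j$ is $\#M'_j$, and $\mathrm{cost}(M)$ is the sum of the costs of all column additions performed. **Boundary matrix.** For a finite simplicial complex with a total order on the simplices of each dimension, the $k$-dimensional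 boundary matrix has rows indexed by the $k$-simplices and columns indexed by the $(k+1)$-simplices, in the given orders, and entry $1$ if the $k$-simplex is a facet of the $(k+1)$-simplex, $0$ otherwise. **Vietoris--Rips filtration.** For a finite point set $\mathcal P_n\subset\mathbb R^d$, the Vietoris--Rips complex at scale $\alpha$ has vertex set $\mathcal P_n$ and contains all simplices $\sigma$ of diameter at most $\alpha$. The entrance time $\rho_\sigma$ of a simplex is the smallest scale at which it belongs to the complex (its diameter). The filtration runs over all scales from $0$ until the full simplex on $n$ vertices is reached, so all $\binom n{k+1}$ $k$-simplices and all $\binom n{k+2}$ $(k+1)$-simplices occur. **$\rho$-lexicographic order.** Simplices are ordered first by entrance time, then by dimension, then lexicographically with respect to the total order on the vertices (here: ascending distance to the origin). Asymptotic constants may depend on $k$ and $d$ only. *)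

theory Defs
  imports
    "HOL-Probability.Probability"
    "HOL-Library.Z2"
    "HOL-Library.While_Combinator"
    "Jordan_Normal_Form.Matrix"
begin

section \<open>Matrix reduction over the field with two elements\<close>

text \<open>Rows and columns are numbered from \<open>0\<close>.\<close>

definition nonzero_rows :: "bit Matrix.vec \<Rightarrow> nat set" where
  "nonzero_rows v = {r. r < dim_vec v \<and> v $ r \<noteq> 0}"

definition is_zero_col :: "bit Matrix.vec \<Rightarrow> bool" where
  "is_zero_col v \<longleftrightarrow> v = 0\<^sub>v (dim_vec v)"

definition low :: "bit Matrix.vec \<Rightarrow> nat" where
  "low v = Max (nonzero_rows v)"

definition col_size :: "bit Matrix.vec \<Rightarrow> nat" where
  "col_size v = card (nonzero_rows v)"

definition mat_size :: "bit mat \<Rightarrow> nat" where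
  "mat_size M = (\<Sum>i<dim_col M. col_size (col M i))"

text \<open>\<open>R\<close> is the list of the columns reduced so far. As \<open>low\<close> is meaningful only for
  non-zero columns, the column \<open>R ! j\<close> is required to be non-zero as well.\<close>

definition pivot_clash :: "bit Matrix.vec list \<Rightarrow> bit Matrix.vec \<Rightarrow> nat \<Rightarrow> bool" where
  "pivot_clash R v j \<longleftrightarrow>
     j < length R \<and> \<not> is_zero_col v \<and> \<not> is_zero_col (R ! j) \<and> low (R ! j) = low v"

text \<open>The state of the loop is the current column together with the cost accumulated so far.
  The non-zero columns reduced earlier have distinct pivots, so the index \<open>j\<close> is in fact unique
  and \<open>LEAST\<close> makes no choice. For columns of equal dimension the loop terminates, since every
  addition cancels the pivot.\<close>

definition reduce_col :: "bit Matrix.vec list \<Rightarrow> bit Matrix.vec \<Rightarrow> bit Matrix.vec \<times> nat" where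
  "reduce_col R v =
     while (\<lambda>(w, c). \<exists>j. pivot_clash R w j)
       (\<lambda>(w, c). let j = (LEAST j. pivot_clash R w j) in (w + R ! j, c + col_size (R ! j)))
       (v, 0)"

definition reduce_cols :: "bit Matrix.vec list \<Rightarrow> bit Matrix.vec list \<times> nat" where
  "reduce_cols vs =
     foldl (\<lambda>(R, c) v. let (w, c') = reduce_col R v in (R @ [w], c + c')) ([], 0) vs"

definition reduced_matrix :: "bit mat \<Rightarrow> bit mat" where
  "reduced_matrix M = mat_of_cols (dim_row M) (fst (reduce_cols (cols M)))"

definition reduction_cost :: "bit mat \<Rightarrow> nat" where
  "reduction_cost M = snd (reduce_cols (cols M))"


section \<open>Vietoris--Rips filtrations\<close>

text \<open>A finite point set with a total order on its points is given as a list \<open>ps\<close>. A simplex is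
  represented by the set of the positions of its vertices in \<open>ps\<close>.\<close>

definition vietoris_rips :: "'a::metric_space list \<Rightarrow> real \<Rightarrow> nat set set" where
  "vietoris_rips ps \<alpha> =
     {\<sigma>. \<sigma> \<noteq> {} \<and> \<sigma> \<subseteq> {..<length ps} \<and> diameter ((!) ps ` \<sigma>) \<le> \<alpha>}"

definition entrance_time :: "'a::metric_space list \<Rightarrow> nat set \<Rightarrow> real" where
  "entrance_time ps \<sigma> = (LEAST \<alpha>. \<sigma> \<in> vietoris_rips ps \<alpha>)"

definition vr_simplices :: "'a::metric_space list \<Rightarrow> nat \<Rightarrow> nat set set" where
  "vr_simplices ps m = {\<sigma> \<in> (\<Union>\<alpha>. vietoris_rips ps \<alpha>). card \<sigma> = Suc m}"

text \<open>The lexicographic comparison is that of the increasing vertex sequences.\<close>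

definition rho_lex_less :: "'a::metric_space list \<Rightarrow> nat set \<Rightarrow> nat set \<Rightarrow> bool" where
  "rho_lex_less ps \<sigma> \<tau> \<longleftrightarrow>
     entrance_time ps \<sigma> < entrance_time ps \<tau> \<or>
     entrance_time ps \<sigma> = entrance_time ps \<tau> \<and>
       (card \<sigma> < card \<tau> \<or>
        card \<sigma> = card \<tau> \<and> (sorted_list_of_set \<sigma>, sorted_list_of_set \<tau>) \<in> lexord less_than)"

definition ordered_simplices :: "'a::metric_space list \<Rightarrow> nat \<Rightarrow> nat set list" where
  "ordered_simplices ps m =
     (THE ss. set ss = vr_simplices ps m \<and> sorted_wrt (rho_lex_less ps) ss)"

definition vr_boundary_matrix :: "'a::metric_space list \<Rightarrow> nat \<Rightarrow> bit mat" where
  "vr_boundary_matrix ps k =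
     (let rows = ordered_simplices ps k; columns = ordered_simplices ps (Suc k)
      in mat (length rows) (length columns)
           (\<lambda>(r, c). if rows ! r \<subseteq> columns ! c then 1 else 0))"

lemma entrance_time_eq_diameter:
  assumes "\<sigma> \<noteq> {}" "\<sigma> \<subseteq> {..<length ps}"
  shows "entrance_time ps \<sigma> = diameter ((!) ps ` \<sigma>)"
  unfolding entrance_time_def by (rule Least_equality) (use assms in \<open>auto simp: vietoris_rips_def\<close>)

lemma vr_simplices_eq: "vr_simplices ps m = {\<sigma>. \<sigma> \<subseteq> {..<length ps} \<and> card \<sigma> = Suc m}"
  by (auto simp: vr_simplices_def vietoris_rips_def)

lemma finite_vr_simplices: "finite (vr_simplices ps m)"
  unfolding vr_simplices_eq by (rule finite_subset[of _ "Pow {..<length ps}"]) auto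

lemma rho_lex_less_irrefl: "\<not> rho_lex_less ps \<sigma> \<sigma>"
  by (auto simp: rho_lex_less_def lexord_irreflexive)

lemma rho_lex_less_trans:
  assumes "rho_lex_less ps \<sigma> \<tau>" "rho_lex_less ps \<tau> \<upsilon>"
  shows "rho_lex_less ps \<sigma> \<upsilon>"
  using assms lexord_trans[of _ _ less_than, OF _ _ trans_less_than]
  unfolding rho_lex_less_def by (smt (verit) less_trans)

lemma rho_lex_less_total:
  assumes "finite \<sigma>" "finite \<tau>" "\<sigma> \<noteq> \<tau>"
  shows "rho_lex_less ps \<sigma> \<tau> \<or> rho_lex_less ps \<tau> \<sigma>"
proof -
  have "sorted_list_of_set \<sigma> \<noteq> sorted_list_of_set \<tau>"
    using assms by (metis set_sorted_list_of_set)
  then show ?thesis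
    using lexord_linear[of less_than "sorted_list_of_set \<sigma>" "sorted_list_of_set \<tau>"]
    unfolding rho_lex_less_def by force
qed

lemma sorted_wrt_unique:
  assumes irr: "\<And>x. \<not> P x x" and tr: "\<And>x y z. P x y \<Longrightarrow> P y z \<Longrightarrow> P x z"
    and "sorted_wrt P xs" "sorted_wrt P ys" "set xs = set ys"
  shows "xs = ys"
  using assms(3-5)
proof (induction xs arbitrary: ys)
  case Nil
  then show ?case by simp
next
  case (Cons x xs)
  then obtain y zs where ys: "ys = y # zs" by (cases ys) auto
  have xy: "x = y"
    using Cons.prems unfolding ys by (metis irr tr insert_iff list.simps(15) sorted_wrt.simps(2))
  have "set xs = set zs"
  proof -
    have "x \<notin> set xs" "x \<notin> set zs"
      using Cons.prems irr unfolding ys xy by auto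
    then show ?thesis
      using Cons.prems(3) unfolding ys xy by auto
  qed
  then show ?case using Cons xy ys by auto
qed

lemma sorted_wrt_exists:
  assumes "finite A"
    and tr: "\<And>x y z. P x y \<Longrightarrow> P y z \<Longrightarrow> P x z"
    and tot: "\<And>x y. x \<in> A \<Longrightarrow> y \<in> A \<Longrightarrow> x \<noteq> y \<Longrightarrow> P x y \<or> P y x"
  shows "\<exists>xs. set xs = A \<and> sorted_wrt P xs"
  using assms(1) tot
proof (induction A rule: finite_induct)
  case empty
  then show ?case by auto
next
  case (insert a A)
  then obtain xs where xs: "set xs = A" "sorted_wrt P xs" by auto
  let ?ys = "filter (\<lambda>x. P x a) xs @ [a] @ filter (\<lambda>x. \<not> P x a) xs"
  have ab: "P a x" if "x \<in> A" "\<not> P x a" for x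
    using insert.prems[of a x] insert.hyps that by auto
  have "sorted_wrt P ?ys"
    using xs ab tr by (auto simp: sorted_wrt_append sorted_wrt_filter intro: tr)
  moreover have "set ?ys = insert a A" using xs by auto
  ultimately show ?case by blast
qed

lemma ordered_simplices:
  "set (ordered_simplices ps m) = vr_simplices ps m"
  "sorted_wrt (rho_lex_less ps) (ordered_simplices ps m)"
proof -
  have "\<exists>ss. set ss = vr_simplices ps m \<and> sorted_wrt (rho_lex_less ps) ss"
  proof (rule sorted_wrt_exists[OF finite_vr_simplices])
    show "rho_lex_less ps \<sigma> \<upsilon>" if "rho_lex_less ps \<sigma> \<tau>" "rho_lex_less ps \<tau> \<upsilon>" for \<sigma> \<tau> \<upsilon>
      using that by (rule rho_lex_less_trans)
    show "rho_lex_less ps \<sigma> \<tau> \<or> rho_lex_less ps \<tau> \<sigma>"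
      if "\<sigma> \<in> vr_simplices ps m" "\<tau> \<in> vr_simplices ps m" "\<sigma> \<noteq> \<tau>" for \<sigma> \<tau>
      using that by (intro rho_lex_less_total) (auto simp: vr_simplices_eq card_ge_0_finite)
  qed
  then have "\<exists>!ss. set ss = vr_simplices ps m \<and> sorted_wrt (rho_lex_less ps) ss"
    using sorted_wrt_unique[of "rho_lex_less ps"] rho_lex_less_irrefl rho_lex_less_trans
    by metis
  from theI'[OF this] show "set (ordered_simplices ps m) = vr_simplices ps m"
    "sorted_wrt (rho_lex_less ps) (ordered_simplices ps m)"
    unfolding ordered_simplices_def by auto
qed


section \<open>Random points in the unit cube\<close>

definition unit_cube :: "(real ^ 'd) set" where
  "unit_cube = cbox (\<chi> i. - 1 / 2) (\<chi> i. 1 / 2)"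

definition iid_uniform_cube :: "'w measure \<Rightarrow> nat \<Rightarrow> (nat \<Rightarrow> 'w \<Rightarrow> real ^ 'd) \<Rightarrow> bool" where
  "iid_uniform_cube M n X \<longleftrightarrow>
     prob_space M \<and>
     prob_space.indep_vars M (\<lambda>_. borel) X {..<n} \<and>
     (\<forall>i<n. distr M borel (X i) = uniform_measure lborel unit_cube)"

text \<open>The sort is stable; points at the same distance to the origin occur with probability \<open>0\<close>.\<close>

definition sorted_sample :: "nat \<Rightarrow> (nat \<Rightarrow> 'w \<Rightarrow> real ^ 'd) \<Rightarrow> 'w \<Rightarrow> (real ^ 'd) list" where
  "sorted_sample n X \<omega> = sort_key norm (map (\<lambda>i. X i \<omega>) [0..<n])"

definition vr_fill_in :: "nat \<Rightarrow> nat \<Rightarrow> (nat \<Rightarrow> 'w \<Rightarrow> real ^ 'd) \<Rightarrow> 'w \<Rightarrow> real" where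
  "vr_fill_in k n X \<omega> = real (mat_size (reduced_matrix (vr_boundary_matrix (sorted_sample n X \<omega>) k)))"

definition vr_cost :: "nat \<Rightarrow> nat \<Rightarrow> (nat \<Rightarrow> 'w \<Rightarrow> real ^ 'd) \<Rightarrow> 'w \<Rightarrow> real" where
  "vr_cost k n X \<omega> = real (reduction_cost (vr_boundary_matrix (sorted_sample n X \<omega>) k))"

end

theory Submission
  imports Defs
begin

text \<open>
  The cost of the reduction follows from the fill-in: during the reduction of one column the pivot
  strictly decreases, so each earlier column is added at most once, and the cost is at most the
  number of columns, which is at most \<open>n ^ (k + 2)\<close>, times the fill-in (\<open>reduction_cost_le\<close>).

  For the fill-in, non-zero reduced columns have distinct pivots, so it suffices to bound the size of
  the column with a given pivot \<open>\<sigma>\<close>, a \<open>k\<close>-simplex of diameter \<open>r\<close>. Almost surely all distances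
  between points differ (\<open>AE_distinct_distances\<close>), so \<open>\<sigma>\<close> has a unique longest edge
  \<open>{a, b}\<close>. Suppose that every point of the cube has a sample point within distance \<open>\<delta>\<close>.

  If \<open>r \<ge> 30 * \<delta>\<close>, the column with pivot \<open>\<sigma>\<close> is unreduced and has only \<open>k + 2\<close> entries. To see this,
  let \<open>y\<close> be the first vertex of \<open>\<sigma>\<close> off the longest edge. If no earlier vertex than \<open>y\<close> extends
  \<open>\<sigma> - {y}\<close> at scale \<open>r\<close>, then \<open>\<sigma>\<close> is the first simplex over \<open>\<sigma> - {y}\<close> with its diameter. A
  cycle whose last simplex is \<open>\<sigma>\<close> would have the coefficient \<open>1\<close> at \<open>\<sigma> - {y}\<close> in its boundary,
  which is absurd; but reduced columns are cycles, so \<open>\<sigma>\<close> is not a pivot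
  (\<open>not_pivot_of_cycle\<close>). Otherwise some \<open>x < y\<close> extends \<open>\<sigma> - {y}\<close>. If \<open>x\<close> is far from \<open>y\<close>,
  the midpoint of \<open>x\<close> and \<open>y\<close> is closer than \<open>r\<close>, by a constant factor, to all vertices
  of \<open>\<sigma>\<close> and no farther from the origin than \<open>y\<close>, so that a sample point near it can take the
  place of \<open>x\<close> (\<open>closer_vertex\<close>). This is where the order by distance to the origin and the
  convexity of balls and cubes enter. So a vertex before \<open>y\<close> extends all of \<open>\<sigma>\<close>. For the first vertex
  \<open>w\<close> that extends \<open>\<sigma>\<close>, the simplex \<open>insert w \<sigma>\<close> is the first coface of \<open>\<sigma>\<close>, and \<open>\<sigma>\<close> is its
  last facet (\<open>apparent_pair\<close>); such a column is never reduced (\<open>apparent_pair_unreduced\<close>).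
  For \<open>k = 1\<close> there is no \<open>y\<close>, and a sample point near the midpoint of the edge is used instead.

  If \<open>r < 30 * \<delta>\<close>, all entries of the column are simplices of diameter less than \<open>30 * \<delta>\<close>. So the
  fill-in is at most \<open>(k + 2) * n ^ (k + 1)\<close> plus the square of the number of such small
  simplices (\<open>fill_in_bound\<close>).

  Finally, divide the cube into about \<open>n / ln n\<close> cells. Up to an event of polynomially small
  probability, every cell contains a point, which allows \<open>\<delta>\<close> to be of the order of the cell width, and
  no cell enlarged by a constant factor contains more than \<open>K = O(ln n)\<close> points. Then there are
  at most \<open>n * K ^ k\<close> small simplices, whose square is the term \<open>n\<^sup>2 * ln n ^ (2 * k)\<close>. On the
  exceptional event the fill-in is still at most \<open>n ^ (2 * k + 2)\<close>, which the probability outweighs.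
\<close>

section \<open>Matrix reduction of an arbitrary matrix\<close>

lemma finite_nonzero_rows [simp]: "finite (nonzero_rows v)"
  by (simp add: nonzero_rows_def)

lemma is_zero_col_iff: "is_zero_col v \<longleftrightarrow> nonzero_rows v = {}"
proof -
  have "v = 0\<^sub>v (dim_vec v) \<longleftrightarrow> (\<forall>r<dim_vec v. v $ r = 0)"
    by (metis eq_vecI index_zero_vec)
  then show ?thesis by (auto simp: is_zero_col_def nonzero_rows_def)
qed

lemma low_in_nonzero_rows: "\<not> is_zero_col v \<Longrightarrow> low v \<in> nonzero_rows v"
  unfolding low_def is_zero_col_iff by (rule Max_in) auto

lemma nonzero_row_le_low: "r \<in> nonzero_rows v \<Longrightarrow> r \<le> low v"
  unfolding low_def by (rule Max_ge) auto

lemma nonzero_rows_add: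
  assumes "v \<in> carrier_vec n" "u \<in> carrier_vec n"
  shows "nonzero_rows (v + u) = (nonzero_rows v - nonzero_rows u) \<union> (nonzero_rows u - nonzero_rows v)"
  using assms by (auto simp: nonzero_rows_def bit_not_zero_iff)

lemma low_add_less:
  assumes "v \<in> carrier_vec n" "u \<in> carrier_vec n" "\<not> is_zero_col v" "\<not> is_zero_col u"
    and "low u = low v" "\<not> is_zero_col (v + u)"
  shows "low (v + u) < low v"
proof -
  have in_sum: "low (v + u) \<in> nonzero_rows (v + u)"
    using assms by (simp add: low_in_nonzero_rows)
  have lv: "low v \<in> nonzero_rows v" "low v \<in> nonzero_rows u"
    using low_in_nonzero_rows assms by metis+
  have "low (v + u) \<in> nonzero_rows v \<or> low (v + u) \<in> nonzero_rows u"
    using in_sum unfolding nonzero_rows_add[OF assms(1,2)] by blast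
  then have "low (v + u) \<le> low v"
    using nonzero_row_le_low assms(5) by metis
  moreover have "low (v + u) \<noteq> low v"
    using in_sum lv unfolding nonzero_rows_add[OF assms(1,2)] by fastforce
  ultimately show ?thesis by simp
qed

text \<open>The pivot of the current column strictly decreases, so each earlier column is added at most
  once; hence the reduction of one column costs at most the total size of the earlier ones.\<close>

lemma reduce_col_correct:
  assumes v: "v \<in> carrier_vec n" and R: "set R \<subseteq> carrier_vec n"
    and Pv: "P v" and PR: "\<And>j. j < length R \<Longrightarrow> P (R ! j)"
    and Padd: "\<And>x y. x \<in> carrier_vec n \<Longrightarrow> y \<in> carrier_vec n \<Longrightarrow> P x \<Longrightarrow> P y \<Longrightarrow> P (x + y)"
    and rc: "reduce_col R v = (w, c)"
  shows "w \<in> carrier_vec n" "P w" "\<not> pivot_clash R w j"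
    and "c \<le> (\<Sum>j<length R. col_size (R ! j))"
proof -
  \<comment> \<open>the earlier columns that can have been added when the current column is \<open>w\<close>\<close>
  define used where "used w = {j. j < length R \<and> (is_zero_col w \<or> low w < low (R ! j))}" for w
  define Inv where "Inv = (\<lambda>(w, c). w \<in> carrier_vec n \<and> P w \<and> c \<le> (\<Sum>j\<in>used w. col_size (R ! j)))"
  define Q where "Q = (\<lambda>(w, c). w \<in> carrier_vec n \<and> P w \<and> c \<le> (\<Sum>j\<in>used w. col_size (R ! j))
      \<and> (\<forall>j. \<not> pivot_clash R w j))"
  have fin: "finite (used w)" for w by (simp add: used_def)
  have "Q (reduce_col R v)"
    unfolding reduce_col_def
  proof (rule while_rule[where P = Inv and r = "Wellfounded.measure (\<lambda>(w, c). if is_zero_col w then 0 else Suc (low w))"])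
    show "Inv (v, 0)" using v Pv by (simp add: Inv_def)
  next
    fix s assume I: "Inv s" and b: "case s of (w, c) \<Rightarrow> \<exists>j. pivot_clash R w j"
    obtain w c where s: "s = (w, c)" by force
    define j where "j = (LEAST j. pivot_clash R w j)"
    have j: "pivot_clash R w j" using b unfolding s j_def by (auto intro: LeastI)
    then have jl: "j < length R" "\<not> is_zero_col w" "\<not> is_zero_col (R ! j)" "low (R ! j) = low w"
      by (auto simp: pivot_clash_def)
    have Rj: "R ! j \<in> carrier_vec n" using R jl by auto
    have w: "w \<in> carrier_vec n" "P w" "c \<le> (\<Sum>j\<in>used w. col_size (R ! j))"
      using I by (auto simp: Inv_def s)
    have less: "is_zero_col (w + R ! j) \<or> low (w + R ! j) < low w"
      using low_add_less[OF w(1) Rj] jl by auto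
    have sub: "insert j (used w) \<subseteq> used (w + R ! j)" and nj: "j \<notin> used w"
      using less jl by (auto simp: used_def)
    have "c + col_size (R ! j) \<le> (\<Sum>j\<in>insert j (used w). col_size (R ! j))"
      using w(3) nj fin by simp
    also have "\<dots> \<le> (\<Sum>j\<in>used (w + R ! j). col_size (R ! j))"
      by (rule sum_mono2) (use sub fin in auto)
    finally show "Inv (case s of (w, c) \<Rightarrow> let j = LEAST j. pivot_clash R w j in (w + R ! j, c + col_size (R ! j)))"
      using w Rj PR jl(1) Padd by (simp add: s Inv_def Let_def flip: j_def)
    show "((case s of (w, c) \<Rightarrow> let j = LEAST j. pivot_clash R w j in (w + R ! j, c + col_size (R ! j))), s)
      \<in> Wellfounded.measure (\<lambda>(w, c). if is_zero_col w then 0 else Suc (low w))"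
      using less jl by (auto simp: s Let_def simp flip: j_def)
  qed (auto simp: Inv_def Q_def)
  then have *: "w \<in> carrier_vec n \<and> P w \<and> c \<le> (\<Sum>j\<in>used w. col_size (R ! j)) \<and> (\<forall>j. \<not> pivot_clash R w j)"
    by (simp add: rc Q_def)
  then show "w \<in> carrier_vec n" "P w" "\<not> pivot_clash R w j" by auto
  have "(\<Sum>j\<in>used w. col_size (R ! j)) \<le> (\<Sum>j<length R. col_size (R ! j))"
    by (rule sum_mono2) (auto simp: used_def)
  with * show "c \<le> (\<Sum>j<length R. col_size (R ! j))" by linarith
qed

lemma reduce_col_no_clash:
  "(\<And>j. \<not> pivot_clash R v j) \<Longrightarrow> reduce_col R v = (v, 0)"
  unfolding reduce_col_def by (subst while_unfold) auto

lemma reduce_cols_snoc: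
  "reduce_cols (vs @ [v]) =
     (case reduce_cols vs of (R, c) \<Rightarrow> case reduce_col R v of (w, c') \<Rightarrow> (R @ [w], c + c'))"
  by (simp add: reduce_cols_def split: prod.splits)

lemma length_reduce_cols [simp]: "length (fst (reduce_cols vs)) = length vs"
proof (induction vs rule: rev_induct)
  case (snoc v vs)
  then show ?case by (simp add: reduce_cols_snoc case_prod_beta)
qed (simp add: reduce_cols_def)

lemma reduce_cols_append:
  "\<exists>S. fst (reduce_cols (vs @ us)) = fst (reduce_cols vs) @ S"
proof (induction us rule: rev_induct)
  case (snoc u us)
  then obtain S where "fst (reduce_cols (vs @ us)) = fst (reduce_cols vs) @ S" by blast
  then show ?case
    by (simp add: reduce_cols_snoc case_prod_beta flip: append_assoc) simp
qed auto

text \<open>Column \<open>i\<close> of the output arises from column \<open>i\<close> of the input by reduction against the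
  columns before it.\<close>

lemma reduce_cols_nth:
  assumes "i < length vs"
  shows "fst (reduce_cols vs) ! i = fst (reduce_col (take i (fst (reduce_cols vs))) (vs ! i))"
proof -
  have vs: "vs = (take i vs @ [vs ! i]) @ drop (Suc i) vs"
    using assms by (simp add: id_take_nth_drop[symmetric])
  obtain S where S: "fst (reduce_cols vs) = fst (reduce_cols (take i vs @ [vs ! i])) @ S"
    using reduce_cols_append vs by metis
  define T where "T = fst (reduce_cols (take i vs))"
  have lenT: "length T = i" using assms by (simp add: T_def)
  have "fst (reduce_cols (take i vs @ [vs ! i])) = T @ [fst (reduce_col T (vs ! i))]"
    by (simp add: T_def reduce_cols_snoc split: prod.splits)
  then show ?thesis by (simp add: S lenT nth_append)
qed

lemma reduce_cols_carrier:
  assumes "set vs \<subseteq> carrier_vec n"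
  shows "set (fst (reduce_cols vs)) \<subseteq> carrier_vec n"
  using assms
proof (induction vs rule: rev_induct)
  case (snoc v vs)
  obtain R c where R: "reduce_cols vs = (R, c)" by force
  obtain w c' where w: "reduce_col R v = (w, c')" by force
  have "w \<in> carrier_vec n"
    by (rule reduce_col_correct(1)[where P = "\<lambda>_. True", OF _ _ _ _ _ w]) (use snoc R in auto)
  then show ?case using snoc R w by (simp add: reduce_cols_snoc)
qed (simp add: reduce_cols_def)

text \<open>A property that is stable under addition and holds for the input columns up to \<open>i\<close> holds for
  the output column \<open>i\<close>, which is a sum of such columns.\<close>

lemma reduce_cols_closed:
  assumes vs: "set vs \<subseteq> carrier_vec n" and i: "i < length vs"
    and P: "\<And>j. j \<le> i \<Longrightarrow> P (vs ! j)"
    and Padd: "\<And>x y. x \<in> carrier_vec n \<Longrightarrow> y \<in> carrier_vec n \<Longrightarrow> P x \<Longrightarrow> P y \<Longrightarrow> P (x + y)"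
  shows "P (fst (reduce_cols vs) ! i)"
  using i P
proof (induction i rule: less_induct)
  case (less i)
  define R where "R = take i (fst (reduce_cols vs))"
  obtain w c where w: "reduce_col R (vs ! i) = (w, c)" by force
  have "P w"
  proof (rule reduce_col_correct(2)[where P = P and n = n, OF _ _ _ _ _ w])
    show "set R \<subseteq> carrier_vec n"
      unfolding R_def by (rule subset_trans[OF set_take_subset reduce_cols_carrier[OF vs]])
    show "vs ! i \<in> carrier_vec n" using vs less.prems by auto
    show "P (R ! j)" if "j < length R" for j
      using that less.IH[of j] less.prems by (auto simp: R_def)
  qed (use less.prems Padd in auto)
  then show ?case using reduce_cols_nth[OF less.prems(1)] w by (simp add: R_def)
qed

lemma reduce_cols_distinct_pivots:
  assumes vs: "set vs \<subseteq> carrier_vec n" and "i < length vs" "j < length vs"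
    and "\<not> is_zero_col (fst (reduce_cols vs) ! i)" "\<not> is_zero_col (fst (reduce_cols vs) ! j)"
    and "low (fst (reduce_cols vs) ! i) = low (fst (reduce_cols vs) ! j)"
  shows "i = j"
proof -
  define R where "R = fst (reduce_cols vs)"
  have main: "low (R ! j) \<noteq> low (R ! i)"
    if ij: "j < i" "i < length vs" and nz: "\<not> is_zero_col (R ! i)" "\<not> is_zero_col (R ! j)" for i j
  proof -
    obtain w c where w: "reduce_col (take i R) (vs ! i) = (w, c)" by force
    have "\<not> pivot_clash (take i R) w j"
    proof (rule reduce_col_correct(3)[where P = "\<lambda>_. True", OF _ _ _ _ _ w])
      show "set (take i R) \<subseteq> carrier_vec n"
        unfolding R_def by (rule subset_trans[OF set_take_subset reduce_cols_carrier[OF vs]])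
      show "vs ! i \<in> carrier_vec n" using vs ij by auto
    qed auto
    moreover have "R ! i = w" using reduce_cols_nth[OF ij(2)] w by (simp add: R_def)
    ultimately show ?thesis using ij nz by (auto simp: pivot_clash_def R_def)
  qed
  show ?thesis
    using main[of i j] main[of j i] assms unfolding R_def by (metis linorder_neqE_nat)
qed

text \<open>So the total cost of the reduction is controlled by the fill-in alone.\<close>

lemma reduction_cost_le:
  "reduction_cost M \<le> dim_col M * mat_size (reduced_matrix M)"
proof -
  define n where "n = dim_row M"
  define total where "total R = (\<Sum>j<length R. col_size (R ! j))" for R :: "bit Matrix.vec list"
  have gen: "snd (reduce_cols vs) \<le> length vs * total (fst (reduce_cols vs))"
    if "set vs \<subseteq> carrier_vec n" for vs
    using that
  proof (induction vs rule: rev_induct)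
    case (snoc v vs)
    obtain R c where R: "reduce_cols vs = (R, c)" by force
    obtain w c' where w: "reduce_col R v = (w, c')" by force
    have "c' \<le> total R"
      unfolding total_def
      by (rule reduce_col_correct(4)[where P = "\<lambda>_. True", OF _ _ _ _ _ w])
         (use snoc reduce_cols_carrier[of vs n] R in auto)
    moreover have "total R \<le> total (R @ [w])"
      by (simp add: total_def nth_append)
    moreover have "c \<le> length vs * total R" using snoc R by simp
    ultimately have "c + c' \<le> length vs * total (R @ [w]) + total (R @ [w])"
      by (meson add_mono le_trans mult_le_mono2)
    then show ?case using R w by (simp add: reduce_cols_snoc)
  qed (simp add: reduce_cols_def)
  have cM: "set (cols M) \<subseteq> carrier_vec n"
    using cols_dim n_def by blast
  have "mat_size (reduced_matrix M) = total (fst (reduce_cols (cols M)))"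
    unfolding mat_size_def reduced_matrix_def total_def
    using reduce_cols_carrier[OF cM]
    by (intro sum.cong) (auto simp: n_def subset_iff intro!: arg_cong[where f = col_size] col_mat_of_cols)
  then show ?thesis
    using gen[OF cM] by (simp add: reduction_cost_def)
qed

lemma mat_size_reduced_matrix:
  "mat_size (reduced_matrix M) = (\<Sum>i<dim_col M. col_size (fst (reduce_cols (cols M)) ! i))"
proof -
  have "set (fst (reduce_cols (cols M))) \<subseteq> carrier_vec (dim_row M)"
    by (rule reduce_cols_carrier) (use cols_dim in blast)
  then show ?thesis
    unfolding mat_size_def reduced_matrix_def
    by (intro sum.cong) (auto simp: subset_iff intro!: arg_cong[where f = col_size] col_mat_of_cols)
qed

section \<open>The order of the simplices\<close>

lemma lexord_insort:
  fixes x y :: nat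
  assumes "sorted xs" "x < y" "x \<notin> set xs"
  shows "(insort x xs, insort y xs) \<in> lexord less_than"
  using assms by (induction xs) (auto simp: not_le)

text \<open>Two simplices that differ in one vertex are compared by that vertex, wherever it stands in the two
  vertex sequences.\<close>

lemma lexord_replace_vertex:
  fixes x y :: nat
  assumes "finite A" "x < y" "x \<notin> A" "y \<notin> A"
  shows "(sorted_list_of_set (insert x A), sorted_list_of_set (insert y A)) \<in> lexord less_than"
  using assms by (simp add: lexord_insort)

lemma rho_lex_less_replace_vertex:
  assumes "finite A" "x < y" "x \<notin> A" "y \<notin> A"
    and "entrance_time ps (insert x A) \<le> entrance_time ps (insert y A)"
  shows "rho_lex_less ps (insert x A) (insert y A)"
  using assms lexord_replace_vertex[OF assms(1-4)] by (auto simp: rho_lex_less_def)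

lemma rho_lex_less_asym: "rho_lex_less ps \<sigma> \<tau> \<Longrightarrow> \<not> rho_lex_less ps \<tau> \<sigma>"
  using rho_lex_less_irrefl rho_lex_less_trans by blast

lemma entrance_time_mono_rho:
  "rho_lex_less ps \<sigma> \<tau> \<Longrightarrow> entrance_time ps \<sigma> \<le> entrance_time ps \<tau>"
  by (auto simp: rho_lex_less_def)

lemma entrance_time_le_iff:
  assumes "\<sigma> \<noteq> {}" "\<sigma> \<subseteq> {..<length ps}"
  shows "entrance_time ps \<sigma> \<le> r \<longleftrightarrow> (\<forall>i\<in>\<sigma>. \<forall>j\<in>\<sigma>. dist (ps ! i) (ps ! j) \<le> r)"
proof -
  have fin: "finite \<sigma>" using assms(2) finite_subset by blast
  have bd: "bounded ((!) ps ` \<sigma>)" using fin by (simp add: finite_imp_bounded)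
  show ?thesis
    unfolding entrance_time_eq_diameter[OF assms]
  proof
    assume "diameter ((!) ps ` \<sigma>) \<le> r"
    then show "\<forall>i\<in>\<sigma>. \<forall>j\<in>\<sigma>. dist (ps ! i) (ps ! j) \<le> r"
      using diameter_bounded_bound[OF bd] by (meson imageI order_trans)
  next
    assume *: "\<forall>i\<in>\<sigma>. \<forall>j\<in>\<sigma>. dist (ps ! i) (ps ! j) \<le> r"
    show "diameter ((!) ps ` \<sigma>) \<le> r"
      unfolding diameter_def using * assms(1) by (auto intro!: cSUP_least)
  qed
qed

lemma entrance_time_attained:
  assumes "\<sigma> \<noteq> {}" "\<sigma> \<subseteq> {..<length ps}"
  shows "\<exists>i\<in>\<sigma>. \<exists>j\<in>\<sigma>. dist (ps ! i) (ps ! j) = entrance_time ps \<sigma>"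
proof -
  have fin: "finite \<sigma>" using assms(2) finite_subset by blast
  define d where "d = (\<lambda>(i, j). dist (ps ! i) (ps ! j)) ` (\<sigma> \<times> \<sigma>)"
  have d: "finite d" "d \<noteq> {}" using fin assms(1) by (auto simp: d_def)
  have "Max d \<in> d" using d by simp
  then obtain i j where ij: "i \<in> \<sigma>" "j \<in> \<sigma>" "dist (ps ! i) (ps ! j) = Max d"
    by (auto simp: d_def)
  have "entrance_time ps \<sigma> \<le> Max d"
    using entrance_time_le_iff[OF assms] d by (auto simp: d_def intro!: Max_ge)
  moreover have "Max d \<le> entrance_time ps \<sigma>"
    using entrance_time_le_iff[OF assms, of "entrance_time ps \<sigma>"] ij by (metis order_refl)
  ultimately show ?thesis using ij by (metis order_antisym)
qed

lemma entrance_time_mono: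
  assumes "\<sigma> \<noteq> {}" "\<sigma> \<subseteq> \<tau>" "\<tau> \<subseteq> {..<length ps}"
  shows "entrance_time ps \<sigma> \<le> entrance_time ps \<tau>"
proof -
  have "\<tau> \<noteq> {}" "\<sigma> \<subseteq> {..<length ps}" using assms by auto
  then show ?thesis
    using entrance_time_le_iff[of \<tau> ps "entrance_time ps \<tau>"] entrance_time_le_iff[of \<sigma> ps "entrance_time ps \<tau>"] assms
    by blast
qed

lemma distinct_ordered_simplices: "distinct (ordered_simplices ps m)"
proof -
  have "distinct xs" if "sorted_wrt (rho_lex_less ps) xs" for xs
    using that by (induction xs) (auto simp: rho_lex_less_irrefl)
  then show ?thesis using ordered_simplices(2) .
qed

lemma length_ordered_simplices: "length (ordered_simplices ps m) = card (vr_simplices ps m)"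
  using distinct_card[OF distinct_ordered_simplices] ordered_simplices(1) by metis

lemma nth_ordered_simplices:
  assumes "r < length (ordered_simplices ps m)"
  shows "ordered_simplices ps m ! r \<subseteq> {..<length ps}" "card (ordered_simplices ps m ! r) = Suc m"
    "finite (ordered_simplices ps m ! r)"
proof -
  have "ordered_simplices ps m ! r \<in> vr_simplices ps m"
    using assms nth_mem ordered_simplices(1) by blast
  then show "ordered_simplices ps m ! r \<subseteq> {..<length ps}" "card (ordered_simplices ps m ! r) = Suc m"
    "finite (ordered_simplices ps m ! r)"
    by (auto simp: vr_simplices_eq intro: card_ge_0_finite)
qed

lemma ordered_simplices_nth_less_iff:
  assumes "r < length (ordered_simplices ps m)" "s < length (ordered_simplices ps m)"
  shows "rho_lex_less ps (ordered_simplices ps m ! r) (ordered_simplices ps m ! s) \<longleftrightarrow> r < s"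
  using sorted_wrt_nth_less[OF ordered_simplices(2), of _ _ ps m] assms rho_lex_less_asym rho_lex_less_irrefl
  by (metis linorder_neqE_nat)

lemma simplex_index:
  assumes "\<sigma> \<subseteq> {..<length ps}" "card \<sigma> = Suc m"
  obtains r where "r < length (ordered_simplices ps m)" "ordered_simplices ps m ! r = \<sigma>"
proof -
  have "\<sigma> \<in> set (ordered_simplices ps m)"
    using assms by (simp add: ordered_simplices vr_simplices_eq)
  then show ?thesis using that by (auto simp: in_set_conv_nth)
qed


section \<open>Columns of the boundary matrix and cycles\<close>

lemma dim_vr_boundary_matrix [simp]:
  "dim_row (vr_boundary_matrix ps k) = length (ordered_simplices ps k)"
  "dim_col (vr_boundary_matrix ps k) = length (ordered_simplices ps (Suc k))"
  by (simp_all add: vr_boundary_matrix_def Let_def)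

lemma cols_vr_boundary_matrix_carrier:
  "set (cols (vr_boundary_matrix ps k)) \<subseteq> carrier_vec (length (ordered_simplices ps k))"
  using cols_dim[of "vr_boundary_matrix ps k"] by simp

lemma nonzero_rows_boundary:
  assumes "t < length (ordered_simplices ps (Suc k))"
  shows "nonzero_rows (cols (vr_boundary_matrix ps k) ! t) =
    {r. r < length (ordered_simplices ps k) \<and> ordered_simplices ps k ! r \<subseteq> ordered_simplices ps (Suc k) ! t}"
  using assms by (auto simp: nonzero_rows_def vr_boundary_matrix_def Let_def split: if_splits)

text \<open>A column is a chain of \<open>k\<close>-simplices with coefficients modulo \<open>2\<close>; its boundary has, at a face
  \<open>\<rho>\<close> with \<open>k\<close> vertices, the parity of the number of simplices over \<open>\<rho>\<close>.\<close>

definition is_cycle :: "'a::metric_space list \<Rightarrow> nat \<Rightarrow> bit Matrix.vec \<Rightarrow> bool" where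
  "is_cycle ps k v \<longleftrightarrow>
     (\<forall>\<rho>. card \<rho> = k \<longrightarrow> finite \<rho> \<longrightarrow> even (card {r \<in> nonzero_rows v. \<rho> \<subseteq> ordered_simplices ps k ! r}))"

lemma even_card_sym_diff:
  assumes "finite A" "finite B" "even (card A)" "even (card B)"
  shows "even (card ((A - B) \<union> (B - A)))"
proof -
  have "card A = card (A - B) + card (A \<inter> B)" "card B = card (B - A) + card (A \<inter> B)"
    using card_Diff_subset_Int[of A B] card_Diff_subset_Int[of B A] assms
      card_mono[of A "A \<inter> B"] card_mono[of B "A \<inter> B"] by (simp_all add: Int_commute)
  moreover have "card ((A - B) \<union> (B - A)) = card (A - B) + card (B - A)"
    using assms by (intro card_Un_disjoint) auto
  ultimately show ?thesis using assms by presburger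
qed

lemma is_cycle_add:
  assumes "v \<in> carrier_vec n" "u \<in> carrier_vec n" "is_cycle ps k v" "is_cycle ps k u"
  shows "is_cycle ps k (v + u)"
  unfolding is_cycle_def
proof (intro allI impI)
  fix \<rho> :: "nat set" assume \<rho>: "card \<rho> = k" "finite \<rho>"
  define F where "F v = {r \<in> nonzero_rows v. \<rho> \<subseteq> ordered_simplices ps k ! r}" for v
  have "F (v + u) = (F v - F u) \<union> (F u - F v)"
    using nonzero_rows_add[OF assms(1,2)] by (auto simp: F_def)
  moreover have "finite (F v)" "finite (F u)" by (auto simp: F_def)
  moreover have "even (card (F v))" "even (card (F u))"
    using assms(3,4) \<rho> by (auto simp: is_cycle_def F_def)
  ultimately show "even (card {r \<in> nonzero_rows (v + u). \<rho> \<subseteq> ordered_simplices ps k ! r})"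
    using even_card_sym_diff by (metis F_def)
qed

lemma inj_on_ordered_simplices: "inj_on ((!) (ordered_simplices ps m)) {..<length (ordered_simplices ps m)}"
  by (rule inj_on_nth[OF distinct_ordered_simplices]) simp

text \<open>Between a simplex and a face of codimension two there are exactly two facets.\<close>

lemma is_cycle_boundary:
  assumes t: "t < length (ordered_simplices ps (Suc k))"
  shows "is_cycle ps k (cols (vr_boundary_matrix ps k) ! t)"
  unfolding is_cycle_def
proof (intro allI impI)
  fix \<rho> :: "nat set" assume \<rho>: "card \<rho> = k" "finite \<rho>"
  define \<tau> where "\<tau> = ordered_simplices ps (Suc k) ! t"
  have \<tau>: "\<tau> \<subseteq> {..<length ps}" "card \<tau> = Suc (Suc k)" "finite \<tau>"
    using nth_ordered_simplices[OF t] by (auto simp: \<tau>_def)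
  define F where "F = {r \<in> nonzero_rows (cols (vr_boundary_matrix ps k) ! t). \<rho> \<subseteq> ordered_simplices ps k ! r}"
  have F: "F = {r. r < length (ordered_simplices ps k) \<and> ordered_simplices ps k ! r \<subseteq> \<tau> \<and> \<rho> \<subseteq> ordered_simplices ps k ! r}"
    using nonzero_rows_boundary[OF t] by (auto simp: F_def \<tau>_def)
  show "even (card F)"
  proof (cases "\<rho> \<subseteq> \<tau>")
    case False
    then have "F = {}" unfolding F by auto
    then show ?thesis by simp
  next
    case True
    then have "card (\<tau> - \<rho>) = 2" using \<rho> \<tau> by (simp add: card_Diff_subset)
    then obtain x y where xy: "\<tau> - \<rho> = {x, y}" "x \<noteq> y" by (auto simp: card_2_iff)
    have "(!) (ordered_simplices ps k) ` F = {insert x \<rho>, insert y \<rho>}"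
    proof (intro equalityI subsetI)
      fix \<sigma> assume "\<sigma> \<in> (!) (ordered_simplices ps k) ` F"
      then have \<sigma>: "\<rho> \<subseteq> \<sigma>" "\<sigma> \<subseteq> \<tau>" "card \<sigma> = Suc k" "finite \<sigma>"
        using nth_ordered_simplices by (auto simp: F)
      then have "card (\<sigma> - \<rho>) = 1" using \<rho> by (simp add: card_Diff_subset)
      then obtain z where z: "\<sigma> - \<rho> = {z}" by (auto simp: card_1_singleton_iff)
      then have "\<sigma> = insert z \<rho>" using \<sigma> by auto
      moreover have "z = x \<or> z = y" using z \<sigma> xy by auto
      ultimately show "\<sigma> \<in> {insert x \<rho>, insert y \<rho>}" by auto
    next
      fix \<sigma> assume "\<sigma> \<in> {insert x \<rho>, insert y \<rho>}"
      then obtain z where z: "\<sigma> = insert z \<rho>" "z \<in> \<tau> - \<rho>" using xy by auto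
      have "card \<sigma> = Suc k" "\<sigma> \<subseteq> {..<length ps}" using z \<rho> \<tau> True by auto
      then obtain r where "r < length (ordered_simplices ps k)" "ordered_simplices ps k ! r = \<sigma>"
        using simplex_index by metis
      then show "\<sigma> \<in> (!) (ordered_simplices ps k) ` F"
        using z True by (intro image_eqI[of _ _ r]) (auto simp: F)
    qed
    moreover have "inj_on ((!) (ordered_simplices ps k)) F"
      by (rule inj_on_subset[OF inj_on_ordered_simplices]) (auto simp: F)
    ultimately have "card F = card {insert x \<rho>, insert y \<rho>}" by (metis card_image)
    moreover have "insert x \<rho> \<noteq> insert y \<rho>" using xy by blast
    ultimately show ?thesis by simp
  qed
qed

lemma is_cycle_reduced:
  assumes "i < length (ordered_simplices ps (Suc k))"
  shows "is_cycle ps k (fst (reduce_cols (cols (vr_boundary_matrix ps k))) ! i)"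
proof (rule reduce_cols_closed[OF cols_vr_boundary_matrix_carrier])
  show "i < length (cols (vr_boundary_matrix ps k))" using assms by simp
  show "is_cycle ps k (cols (vr_boundary_matrix ps k) ! j)" if "j \<le> i" for j
    using that assms by (intro is_cycle_boundary) simp
qed (rule is_cycle_add)

text \<open>Here \<open>y\<close> is the first vertex that extends the face \<open>\<sigma> - {y}\<close> without increasing its entrance
  time. Any other simplex over this face comes after \<open>\<sigma>\<close>, so a chain with last simplex \<open>\<sigma>\<close>
  has the coefficient \<open>1\<close> at \<open>\<sigma> - {y}\<close> in its boundary.\<close>

lemma not_pivot_of_cycle:
  assumes v: "v \<in> carrier_vec (length (ordered_simplices ps k))" "is_cycle ps k v" "\<not> is_zero_col v"
    and \<sigma>: "\<sigma> = ordered_simplices ps k ! low v"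
    and y: "y \<in> \<sigma>" "\<sigma> - {y} \<noteq> {}" "entrance_time ps (\<sigma> - {y}) = entrance_time ps \<sigma>"
    and min: "\<And>x. x < length ps \<Longrightarrow> x \<notin> \<sigma> - {y} \<Longrightarrow>
      (\<And>z. z \<in> \<sigma> - {y} \<Longrightarrow> dist (ps ! x) (ps ! z) \<le> entrance_time ps \<sigma>) \<Longrightarrow> y \<le> x"
  shows False
proof -
  define \<rho> where "\<rho> = \<sigma> - {y}"
  have sub: "nonzero_rows v \<subseteq> {..<length (ordered_simplices ps k)}"
    using v(1) by (auto simp: nonzero_rows_def)
  have low: "low v \<in> nonzero_rows v" using v(3) by (rule low_in_nonzero_rows)
  then have lowl: "low v < length (ordered_simplices ps k)" using sub by auto
  have \<sigma>': "\<sigma> \<subseteq> {..<length ps}" "card \<sigma> = Suc k" "finite \<sigma>"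
    using nth_ordered_simplices[OF lowl] \<sigma> by auto
  have \<rho>: "finite \<rho>" "card \<rho> = k" "\<sigma> = insert y \<rho>" "y \<notin> \<rho>" "\<rho> \<noteq> {}" "\<rho> \<subseteq> {..<length ps}"
    using \<sigma>' y by (auto simp: \<rho>_def)
  have "{r \<in> nonzero_rows v. \<rho> \<subseteq> ordered_simplices ps k ! r} = {low v}"
  proof (intro equalityI subsetI)
    fix r assume "r \<in> {r \<in> nonzero_rows v. \<rho> \<subseteq> ordered_simplices ps k ! r}"
    then have r: "r \<in> nonzero_rows v" "\<rho> \<subseteq> ordered_simplices ps k ! r" "r < length (ordered_simplices ps k)"
      using sub by auto
    define \<sigma>2 where "\<sigma>2 = ordered_simplices ps k ! r"
    have \<sigma>2: "\<sigma>2 \<subseteq> {..<length ps}" "card \<sigma>2 = Suc k" "finite \<sigma>2"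
      using nth_ordered_simplices[OF r(3)] by (auto simp: \<sigma>2_def)
    have "card (\<sigma>2 - \<rho>) = 1" using \<rho> \<sigma>2 r(2) by (simp add: card_Diff_subset \<sigma>2_def)
    then obtain x where "\<sigma>2 - \<rho> = {x}" by (auto simp: card_1_singleton_iff)
    then have x: "\<sigma>2 = insert x \<rho>" "x \<notin> \<rho>" "x < length ps"
      using r(2) \<sigma>2 by (auto simp: \<sigma>2_def)
    show "r \<in> {low v}"
    proof (rule ccontr)
      assume "r \<notin> {low v}"
      then have "r < low v" using nonzero_row_le_low[OF r(1)] by simp
      then have less: "rho_lex_less ps \<sigma>2 \<sigma>"
        using ordered_simplices_nth_less_iff[OF r(3) lowl] by (simp add: \<sigma>2_def \<sigma>)
      then have le: "entrance_time ps \<sigma>2 \<le> entrance_time ps \<sigma>" by (rule entrance_time_mono_rho)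
      have "\<forall>z\<in>\<rho>. dist (ps ! x) (ps ! z) \<le> entrance_time ps \<sigma>"
        using entrance_time_le_iff[of \<sigma>2 ps "entrance_time ps \<sigma>"] le \<sigma>2 x by auto
      then have "y \<le> x" using min[of x] x by (auto simp: \<rho>_def)
      moreover have "y \<noteq> x" using less x \<rho> rho_lex_less_irrefl by metis
      ultimately have "y < x" by simp
      moreover have "entrance_time ps \<sigma> \<le> entrance_time ps \<sigma>2"
        using entrance_time_mono[of \<rho> \<sigma>2 ps] \<rho>(5) \<sigma>2 x y(3) by (auto simp: \<rho>_def)
      ultimately have "rho_lex_less ps \<sigma> \<sigma>2"
        using rho_lex_less_replace_vertex[of \<rho> y x ps] \<rho> x by simp
      then show False using less rho_lex_less_asym by blast
    qed
  next
    fix r assume "r \<in> {low v}"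
    then show "r \<in> {r \<in> nonzero_rows v. \<rho> \<subseteq> ordered_simplices ps k ! r}"
      using low \<sigma> \<rho> by auto
  qed
  then have "\<not> even (card {r \<in> nonzero_rows v. \<rho> \<subseteq> ordered_simplices ps k ! r})" by simp
  then show False using v(2) \<rho> by (auto simp: is_cycle_def)
qed

definition distinct_distances :: "'a::metric_space list \<Rightarrow> bool" where
  "distinct_distances ps \<longleftrightarrow>
     (\<forall>i j k l. i < j \<longrightarrow> j < length ps \<longrightarrow> k < l \<longrightarrow> l < length ps \<longrightarrow>
        dist (ps ! i) (ps ! j) = dist (ps ! k) (ps ! l) \<longrightarrow> i = k \<and> j = l)"

lemma distinct_distancesD:
  assumes "distinct_distances ps" "i \<noteq> j" "k \<noteq> l"
    and "i < length ps" "j < length ps" "k < length ps" "l < length ps"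
    and "dist (ps ! i) (ps ! j) = dist (ps ! k) (ps ! l)"
  shows "{i, j} = {k, l}"
proof -
  have "min i j = min k l \<and> max i j = max k l"
    using assms unfolding distinct_distances_def
    by (intro assms(1)[unfolded distinct_distances_def, rule_format])
       (auto simp: min_def max_def dist_commute)
  then show ?thesis by (auto simp: min_def max_def split: if_splits)
qed

text \<open>An apparent pair: among the cofaces of \<open>\<sigma>\<close> with the same longest edge \<open>{a, b}\<close>, the first
  one, \<open>\<tau>\<close>, adds the smallest possible vertex. When this vertex precedes those of
  \<open>\<sigma>\<close> off the edge, \<open>\<sigma>\<close> is the last facet of \<open>\<tau>\<close>, because the facets of
  \<open>\<tau>\<close> that miss \<open>a\<close> or \<open>b\<close> enter earlier.\<close>

lemma apparent_pair:
  assumes dd: "distinct_distances ps"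
    and s: "s < length (ordered_simplices ps k)" "\<sigma> = ordered_simplices ps k ! s"
    and ab: "a \<in> \<sigma>" "b \<in> \<sigma>" "a \<noteq> b" "dist (ps ! a) (ps ! b) = entrance_time ps \<sigma>"
    and x: "x < length ps" "x \<notin> \<sigma>" "\<And>z. z \<in> \<sigma> - {a, b} \<Longrightarrow> x < z"
      "\<And>z. z \<in> \<sigma> \<Longrightarrow> dist (ps ! x) (ps ! z) \<le> entrance_time ps \<sigma>"
  obtains t where "t < length (ordered_simplices ps (Suc k))"
    "\<not> is_zero_col (cols (vr_boundary_matrix ps k) ! t)"
    "low (cols (vr_boundary_matrix ps k) ! t) = s"
    "\<And>t'. t' < t \<Longrightarrow> s \<notin> nonzero_rows (cols (vr_boundary_matrix ps k) ! t')"
proof -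
  define r where "r = entrance_time ps \<sigma>"
  have \<sigma>: "\<sigma> \<subseteq> {..<length ps}" "card \<sigma> = Suc k" "finite \<sigma>" "\<sigma> \<noteq> {}"
    using nth_ordered_simplices[OF s(1)] s(2) ab by auto
  define adm where "adm z \<longleftrightarrow> z < length ps \<and> z \<notin> \<sigma> \<and> (\<forall>v\<in>\<sigma>. dist (ps ! z) (ps ! v) \<le> r)" for z
  define w where "w = (LEAST z. adm z)"
  have "adm x" using x by (auto simp: adm_def r_def)
  then have w: "adm w" "w \<le> x" by (auto simp: w_def intro: LeastI Least_le)
  have wmin: "w \<le> z" if "adm z" for z using that by (auto simp: w_def intro: Least_le)
  have wless: "w < z" if "z \<in> \<sigma> - {a, b}" for z using x(3)[OF that] w by simp
  define \<tau> where "\<tau> = insert w \<sigma>"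
  have \<tau>: "\<tau> \<subseteq> {..<length ps}" "card \<tau> = Suc (Suc k)" "finite \<tau>" "\<tau> \<noteq> {}"
    using \<sigma> w by (auto simp: \<tau>_def adm_def)
  have r0: "r \<ge> 0" using ab(4) by (metis r_def zero_le_dist)
  have "\<forall>i\<in>\<sigma>. \<forall>j\<in>\<sigma>. dist (ps ! i) (ps ! j) \<le> r"
    using entrance_time_le_iff[OF \<sigma>(4,1), of r] by (simp add: r_def)
  then have \<tau>dist: "\<forall>i\<in>\<tau>. \<forall>j\<in>\<tau>. dist (ps ! i) (ps ! j) \<le> r"
    using w(1) r0 by (auto simp: \<tau>_def adm_def dist_commute)
  have et\<tau>: "entrance_time ps \<tau> = r"
  proof (rule antisym)
    show "entrance_time ps \<tau> \<le> r" using entrance_time_le_iff[OF \<tau>(4,1), of r] \<tau>dist by blast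
    show "r \<le> entrance_time ps \<tau>"
      using entrance_time_mono[OF \<sigma>(4) _ \<tau>(1)] by (auto simp: r_def \<tau>_def)
  qed
  obtain t where t: "t < length (ordered_simplices ps (Suc k))" "ordered_simplices ps (Suc k) ! t = \<tau>"
    using simplex_index[OF \<tau>(1,2)] by metis
  define D where "D = cols (vr_boundary_matrix ps k)"
  have nzD: "nonzero_rows (D ! t') = {r. r < length (ordered_simplices ps k) \<and>
      ordered_simplices ps k ! r \<subseteq> ordered_simplices ps (Suc k) ! t'}" if "t' \<le> t" for t'
    using nonzero_rows_boundary[of t' ps k] that t(1) by (simp add: D_def)
  have sin: "s \<in> nonzero_rows (D ! t)"
    using s t nzD[of t] by (auto simp: \<tau>_def)
  have last: "r' \<le> s" if "r' \<in> nonzero_rows (D ! t)" for r'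
  proof (rule ccontr)
    assume "\<not> r' \<le> s"
    then have r': "s < r'" "r' < length (ordered_simplices ps k)" "ordered_simplices ps k ! r' \<subseteq> \<tau>"
      using that nzD[of t] t(2) by auto
    define \<phi> where "\<phi> = ordered_simplices ps k ! r'"
    have \<phi>: "\<phi> \<subseteq> \<tau>" "card \<phi> = Suc k" "finite \<phi>" "\<phi> \<subseteq> {..<length ps}" "\<phi> \<noteq> {}"
      using nth_ordered_simplices[OF r'(2)] r'(3) by (auto simp: \<phi>_def)
    have less: "rho_lex_less ps \<sigma> \<phi>"
      using ordered_simplices_nth_less_iff[OF s(1) r'(2)] r'(1) s(2) by (simp add: \<phi>_def)
    have "card (\<tau> - \<phi>) = 1" using \<phi> \<tau> by (simp add: card_Diff_subset)
    then obtain v where "\<tau> - \<phi> = {v}" by (auto simp: card_1_singleton_iff)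
    then have v: "v \<in> \<tau>" "\<phi> = \<tau> - {v}" using \<phi>(1) by auto
    have "v \<noteq> w" using v less w(1) by (auto simp: \<tau>_def adm_def rho_lex_less_irrefl)
    then have v\<sigma>: "v \<in> \<sigma>" using v by (auto simp: \<tau>_def)
    show False
    proof (cases "v \<in> {a, b}")
      case True
      obtain i j where ij: "i \<in> \<phi>" "j \<in> \<phi>" "dist (ps ! i) (ps ! j) = entrance_time ps \<phi>"
        using entrance_time_attained[OF \<phi>(5,4)] by blast
      have "entrance_time ps \<phi> \<le> r"
        using entrance_time_mono[OF \<phi>(5,1) \<tau>(1)] et\<tau> by simp
      moreover have "r \<le> entrance_time ps \<phi>"
        using entrance_time_mono_rho[OF less] by (simp add: r_def)
      ultimately have eq: "dist (ps ! i) (ps ! j) = dist (ps ! a) (ps ! b)"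
        using ij(3) ab(4) by (simp add: r_def)
      have "{i, j} \<noteq> {a, b}" using ij v True by auto
      moreover have "i \<noteq> j"
      proof
        assume "i = j"
        then have "dist (ps ! a) (ps ! b) = 0" using eq by simp
        \<comment> \<open>coinciding vertices \<open>a\<close>, \<open>b\<close> would make all distances within \<open>\<tau>\<close> vanish\<close>
        then have "dist (ps ! a) (ps ! w) = dist (ps ! a) (ps ! b)"
        proof -
          have "dist (ps ! a) (ps ! w) \<le> r" using \<tau>dist ab(1) by (simp add: \<tau>_def)
          then show ?thesis using \<open>dist (ps ! a) (ps ! b) = 0\<close> ab(4) by (simp add: r_def)
        qed
        moreover have "w \<noteq> a" "w \<noteq> b" "w < length ps" using w(1) ab by (auto simp: adm_def)
        ultimately have "{a, w} = {a, b}"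
          using distinct_distancesD[OF dd, of a w a b] ab \<sigma>(1) by auto
        then show False using \<open>w \<noteq> b\<close> ab(3) by (auto simp: doubleton_eq_iff)
      qed
      ultimately show False
        using distinct_distancesD[OF dd _ ab(3) _ _ _ _ eq] ij(1,2) \<phi>(4) ab(1,2) \<sigma>(1) by blast
    next
      case False
      then have "w < v" using wless v\<sigma> by auto
      define A where "A = \<sigma> - {v}"
      have A: "\<phi> = insert w A" "\<sigma> = insert v A" "w \<notin> A" "v \<notin> A" "finite A"
        using v v\<sigma> w(1) \<open>v \<noteq> w\<close> \<sigma>(3) by (auto simp: A_def \<tau>_def adm_def)
      have "entrance_time ps \<phi> \<le> entrance_time ps \<sigma>"
        using entrance_time_mono[OF \<phi>(5,1) \<tau>(1)] et\<tau> by (simp add: r_def)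
      then have "rho_lex_less ps \<phi> \<sigma>"
        using rho_lex_less_replace_vertex[OF A(5) \<open>w < v\<close> A(3,4)] A(1,2) by simp
      then show False using less rho_lex_less_asym by blast
    qed
  qed
  have first: "s \<notin> nonzero_rows (D ! t')" if t': "t' < t" for t'
  proof
    assume "s \<in> nonzero_rows (D ! t')"
    define \<tau>2 where "\<tau>2 = ordered_simplices ps (Suc k) ! t'"
    have t'l: "t' < length (ordered_simplices ps (Suc k))" using t' t by simp
    have \<tau>2: "\<tau>2 \<subseteq> {..<length ps}" "card \<tau>2 = Suc (Suc k)" "finite \<tau>2"
      using nth_ordered_simplices[OF t'l] by (auto simp: \<tau>2_def)
    have sub: "\<sigma> \<subseteq> \<tau>2"
      using \<open>s \<in> nonzero_rows (D ! t')\<close> nzD[of t'] t' s(2) by (auto simp: \<tau>2_def)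
    have less: "rho_lex_less ps \<tau>2 \<tau>"
      using ordered_simplices_nth_less_iff[OF t'l t(1)] t' t(2) by (simp add: \<tau>2_def)
    have "card (\<tau>2 - \<sigma>) = 1" using \<sigma> \<tau>2 sub by (simp add: card_Diff_subset)
    then obtain z where "\<tau>2 - \<sigma> = {z}" by (auto simp: card_1_singleton_iff)
    then have z: "\<tau>2 = insert z \<sigma>" "z \<notin> \<sigma>" using sub by auto
    have le: "entrance_time ps \<tau>2 \<le> r" using entrance_time_mono_rho[OF less] et\<tau> by simp
    then have "adm z"
      using entrance_time_le_iff[of \<tau>2 ps r] \<tau>2 z by (auto simp: adm_def)
    then have "w \<le> z" by (rule wmin)
    moreover have "w \<noteq> z" using less z by (auto simp: \<tau>_def rho_lex_less_irrefl)
    ultimately have "w < z" by simp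
    moreover have "r \<le> entrance_time ps \<tau>2"
      using entrance_time_mono[OF \<sigma>(4) sub \<tau>2(1)] by (simp add: r_def)
    ultimately have "rho_lex_less ps \<tau> \<tau>2"
      using rho_lex_less_replace_vertex[of \<sigma> w z ps] \<sigma>(3) w(1) z et\<tau> by (auto simp: \<tau>_def adm_def)
    then show False using less rho_lex_less_asym by blast
  qed
  show ?thesis
  proof (rule that[of t])
    show nz: "\<not> is_zero_col (cols (vr_boundary_matrix ps k) ! t)"
      using sin by (auto simp: is_zero_col_iff D_def)
    show "low (cols (vr_boundary_matrix ps k) ! t) = s"
      using last[OF low_in_nonzero_rows] nonzero_row_le_low[OF sin] nz by (auto simp: D_def intro!: antisym)
  qed (use t(1) first in \<open>auto simp: D_def\<close>)
qed

text \<open>The first coface of \<open>\<sigma>\<close> has no earlier column to be reduced with: earlier columns, reduced or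
  not, avoid the row of \<open>\<sigma>\<close>. So it keeps its pivot, and pivots are unique.\<close>

lemma apparent_pair_unreduced:
  assumes i: "i < length (ordered_simplices ps (Suc k))"
    and t: "t < length (ordered_simplices ps (Suc k))"
      "\<not> is_zero_col (cols (vr_boundary_matrix ps k) ! t)"
      "\<And>t'. t' < t \<Longrightarrow> low (cols (vr_boundary_matrix ps k) ! t) \<notin> nonzero_rows (cols (vr_boundary_matrix ps k) ! t')"
    and R: "R = fst (reduce_cols (cols (vr_boundary_matrix ps k)))"
    and nz: "\<not> is_zero_col (R ! i)" and low: "low (R ! i) = low (cols (vr_boundary_matrix ps k) ! t)"
  shows "R ! i = cols (vr_boundary_matrix ps k) ! t"
proof -
  define D where "D = cols (vr_boundary_matrix ps k)"
  define s where "s = low (D ! t)"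
  have lenD: "length D = length (ordered_simplices ps (Suc k))" by (simp add: D_def)
  have carr: "set D \<subseteq> carrier_vec (length (ordered_simplices ps k))"
    unfolding D_def by (rule cols_vr_boundary_matrix_carrier)
  have R': "R = fst (reduce_cols D)" by (simp add: R D_def)
  have no_s: "s \<notin> nonzero_rows (R ! j)" if j: "j < t" for j
    unfolding R'
  proof (rule reduce_cols_closed[OF carr])
    show "j < length D" using j t(1) lenD by simp
    show "s \<notin> nonzero_rows (D ! j')" if "j' \<le> j" for j'
      using t(3)[of j'] that j by (simp add: s_def D_def)
    show "s \<notin> nonzero_rows (x + y)" if "x \<in> carrier_vec (length (ordered_simplices ps k))"
      "y \<in> carrier_vec (length (ordered_simplices ps k))" "s \<notin> nonzero_rows x" "s \<notin> nonzero_rows y" for x y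
      using nonzero_rows_add[OF that(1,2)] that(3,4) by auto
  qed
  have "\<not> pivot_clash (take t R) (D ! t) j" for j
    using no_s[of j] low_in_nonzero_rows[of "R ! j"] by (auto simp: pivot_clash_def s_def)
  then have Rt: "R ! t = D ! t"
    using reduce_cols_nth[of t D] reduce_col_no_clash t(1) lenD by (simp add: R')
  have "i = t"
    using reduce_cols_distinct_pivots[OF carr, of i t] i t nz low Rt lenD
    by (simp add: D_def R' R)
  then show ?thesis using Rt by (simp add: D_def)
qed

lemma col_size_boundary_le:
  assumes t: "t < length (ordered_simplices ps (Suc k))"
  shows "col_size (cols (vr_boundary_matrix ps k) ! t) \<le> k + 2"
proof -
  define \<tau> where "\<tau> = ordered_simplices ps (Suc k) ! t"
  have \<tau>: "card \<tau> = Suc (Suc k)" "finite \<tau>"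
    using nth_ordered_simplices[OF t] by (auto simp: \<tau>_def)
  define F where "F = nonzero_rows (cols (vr_boundary_matrix ps k) ! t)"
  have F: "F = {r. r < length (ordered_simplices ps k) \<and> ordered_simplices ps k ! r \<subseteq> \<tau>}"
    using nonzero_rows_boundary[OF t] by (simp add: F_def \<tau>_def)
  have "card F = card ((!) (ordered_simplices ps k) ` F)"
    by (rule card_image[symmetric], rule inj_on_subset[OF inj_on_ordered_simplices]) (auto simp: F)
  also have "\<dots> \<le> card ((\<lambda>v. \<tau> - {v}) ` \<tau>)"
  proof (intro card_mono subsetI)
    fix \<sigma> assume "\<sigma> \<in> (!) (ordered_simplices ps k) ` F"
    then have \<sigma>: "\<sigma> \<subseteq> \<tau>" "card \<sigma> = Suc k" "finite \<sigma>" using nth_ordered_simplices by (auto simp: F)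
    then have "card (\<tau> - \<sigma>) = 1" using \<tau> by (simp add: card_Diff_subset)
    then obtain v where "\<tau> - \<sigma> = {v}" by (auto simp: card_1_singleton_iff)
    then show "\<sigma> \<in> (\<lambda>v. \<tau> - {v}) ` \<tau>" using \<sigma> by (intro image_eqI[of _ _ v]) auto
  qed (use \<tau> in auto)
  also have "\<dots> \<le> k + 2" using card_image_le[OF \<tau>(2)] \<tau> by (metis add_2_eq_Suc')
  finally show ?thesis by (simp add: col_size_def F_def)
qed

section \<open>Vertices close to a large simplex\<close>

lemma midpoint_dist_sq:
  fixes x y z :: "'a::real_inner"
  shows "(dist ((1/2) *\<^sub>R (x + y)) z)\<^sup>2 = ((dist x z)\<^sup>2 + (dist y z)\<^sup>2) / 2 - (dist x y)\<^sup>2 / 4"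
  unfolding dist_norm power2_norm_eq_inner
  by (simp add: inner_diff_left inner_diff_right inner_add_left inner_add_right inner_commute field_simps)

text \<open>If \<open>x\<close>, \<open>y\<close> are at least \<open>r\<close> apart but both within \<open>r\<close> of \<open>z\<close>, their midpoint is
  closer to \<open>z\<close> by a constant factor; \<open>22/25\<close> is an upper bound of \<open>sqrt 3 / 2\<close>.\<close>

lemma midpoint_dist_le:
  fixes x y z :: "'a::real_inner"
  assumes "dist x z \<le> r" "dist y z \<le> r" "r \<le> dist x y" "0 \<le> r"
  shows "dist ((1/2) *\<^sub>R (x + y)) z \<le> 22/25 * r"
proof (rule power2_le_imp_le)
  have "(dist x z)\<^sup>2 \<le> r\<^sup>2" "(dist y z)\<^sup>2 \<le> r\<^sup>2" "r\<^sup>2 \<le> (dist x y)\<^sup>2"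
    using assms by (auto intro: power_mono)
  then have "(dist ((1/2) *\<^sub>R (x + y)) z)\<^sup>2 \<le> (r\<^sup>2 + r\<^sup>2) / 2 - r\<^sup>2 / 4"
    unfolding midpoint_dist_sq by (simp add: field_simps)
  also have "\<dots> \<le> (22/25 * r)\<^sup>2" by (simp add: power2_eq_square field_simps)
  finally show "(dist ((1/2) *\<^sub>R (x + y)) z)\<^sup>2 \<le> (22/25 * r)\<^sup>2" .
qed (use assms in simp)

text \<open>For the cube, \<open>K\<close> is convex and contains the origin, so it is closed under taking midpoints and
  under moving points towards the origin; the points \<open>ps\<close> are \<open>\<delta>\<close>-dense in it.\<close>

locale dense_sorted_points =
  fixes ps :: "'a::real_inner list" and K :: "'a set" and \<delta> :: real
  assumes sorted: "\<And>i j. i < j \<Longrightarrow> j < length ps \<Longrightarrow> norm (ps ! i) \<le> norm (ps ! j)"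
    and convex: "convex K" and origin: "0 \<in> K" and in_K: "set ps \<subseteq> K"
    and dense: "\<And>z. z \<in> K \<Longrightarrow> \<exists>p\<in>set ps. dist p z \<le> \<delta>"
    and delta: "\<delta> > 0"
begin

lemma nth_in_K: "i < length ps \<Longrightarrow> ps ! i \<in> K"
  using in_K by auto

lemma midpoint_in_K: "x \<in> K \<Longrightarrow> y \<in> K \<Longrightarrow> (1/2) *\<^sub>R (x + y) \<in> K"
  using convexD[OF convex, of x y "1/2" "1/2"] by (simp add: scaleR_add_right)

lemma point_near:
  assumes "z \<in> K"
  obtains i where "i < length ps" "dist (ps ! i) z \<le> \<delta>"
  using dense[OF assms] by (auto simp: in_set_conv_nth)

lemma vertex_in_lune:
  assumes "a < length ps" "b < length ps" "dist (ps ! a) (ps ! b) = r" "30 * \<delta> \<le> r"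
  obtains x where "x < length ps" "dist (ps ! x) (ps ! a) < r" "dist (ps ! x) (ps ! b) < r"
proof -
  define m where "m = (1/2) *\<^sub>R (ps ! a + ps ! b)"
  have m: "m \<in> K" unfolding m_def using assms nth_in_K midpoint_in_K by blast
  obtain x where x: "x < length ps" "dist (ps ! x) m \<le> \<delta>" using point_near[OF m] .
  have "dist m (ps ! a) \<le> 22/25 * r" "dist m (ps ! b) \<le> 22/25 * r"
    unfolding m_def using assms delta by (intro midpoint_dist_le; simp add: dist_commute)+
  then have "dist (ps ! x) (ps ! a) < r" "dist (ps ! x) (ps ! b) < r"
    using x(2) assms(4) delta dist_triangle[of "ps ! x" "ps ! a" m]
      dist_triangle[of "ps ! x" "ps ! b" m] by linarith+
  then show ?thesis using that x by blast
qed

text \<open>Here \<open>x\<close> extends the simplex with vertices \<open>Z\<close>, as \<open>y\<close> does, and is no farther from the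
  origin than \<open>y\<close>, but is too far from \<open>y\<close> itself. The midpoint of \<open>x\<close> and \<open>y\<close> is well within distance \<open>r\<close> of all of \<open>Z\<close>. It is also
  well within \<open>r\<close> of \<open>y\<close>, since \<open>x\<close> and \<open>y\<close> are both close to the midpoint of the edge
  \<open>{a, b}\<close>. By convexity of the norm it is no farther from the origin than \<open>y\<close> either. As there
  is a sample point only within \<open>\<delta>\<close> of any given point, the midpoint is first moved by
  \<open>2 * \<delta>\<close> towards the origin, which makes the sample point strictly closer to the origin
  than \<open>y\<close>.\<close>

lemma closer_vertex:
  assumes x: "x < length ps" and y: "y < length ps" and xy: "norm (ps ! x) \<le> norm (ps ! y)"
    and far: "dist (ps ! x) (ps ! y) > r" and r: "30 * \<delta> \<le> r"
    and Z: "\<And>z. z \<in> Z \<Longrightarrow> dist (ps ! x) z \<le> r \<and> dist (ps ! y) z \<le> r"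
    and ab: "a \<in> Z" "b \<in> Z" "dist a b = r"
  obtains w where "w < y" "\<And>z. z \<in> Z \<Longrightarrow> dist (ps ! w) z < r" "dist (ps ! w) (ps ! y) < r"
proof -
  have r0: "r > 0" using r delta by linarith
  define X where "X = ps ! x"
  define Y where "Y = ps ! y"
  define m where "m = (1/2) *\<^sub>R (X + Y)"
  have mK: "m \<in> K" unfolding m_def X_def Y_def using x y nth_in_K midpoint_in_K by blast
  have mZ: "dist m z \<le> 22/25 * r" if "z \<in> Z" for z
    unfolding m_def using Z[OF that] far r0 by (intro midpoint_dist_le) (auto simp: X_def Y_def)
  define c where "c = (1/2) *\<^sub>R (a + b)"
  have "dist c X \<le> 22/25 * r" "dist c Y \<le> 22/25 * r"
    unfolding c_def using Z ab r0 by (intro midpoint_dist_le; simp add: X_def Y_def dist_commute)+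
  then have "dist X Y \<le> 2 * (22/25 * r)" using dist_triangle3[of X Y c] by linarith
  moreover have "dist m Y = dist X Y / 2"
  proof -
    have "m - Y = (1/2) *\<^sub>R (X - Y)" by (simp add: m_def algebra_simps flip: scaleR_add_left)
    then show ?thesis by (simp add: dist_norm)
  qed
  ultimately have mY: "dist m Y \<le> 22/25 * r" by simp
  have "norm m \<le> (norm X + norm Y) / 2" unfolding m_def using norm_triangle_ineq[of X Y] by simp
  then have nm: "norm m \<le> norm Y" using xy by (simp add: X_def Y_def)
  have nY: "norm Y \<ge> r / 2"
    using far xy norm_triangle_ineq4[of X Y] by (simp add: X_def Y_def dist_norm)
  \<comment> \<open>if \<open>m\<close> is too close to the origin to be moved, the origin itself serves\<close>
  obtain m' where m': "m' \<in> K" "dist m' m \<le> 2 * \<delta>" "norm m' + \<delta> < norm Y"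
  proof (cases "norm m < 2 * \<delta>")
    case True
    show ?thesis
      by (rule that[of 0]) (use origin True nY r delta in \<open>auto simp: dist_norm\<close>)
  next
    case False
    define u where "u = 1 - 2 * \<delta> / norm m"
    have nm0: "norm m > 0" using False delta by linarith
    have u: "0 \<le> u" "u \<le> 1" using False nm0 delta by (auto simp: u_def field_simps)
    have "u *\<^sub>R m + (1 - u) *\<^sub>R 0 \<in> K"
      using convexD[OF convex mK origin, of u "1 - u"] u by simp
    moreover have "dist (u *\<^sub>R m) m = 2 * \<delta>"
    proof -
      have "u *\<^sub>R m - m = (u - 1) *\<^sub>R m" by (simp add: scaleR_left_diff_distrib)
      then show ?thesis using nm0 delta by (simp add: dist_norm u_def)
    qed
    moreover have "norm (u *\<^sub>R m) = norm m - 2 * \<delta>"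
      using u(1) nm0 by (simp add: u_def left_diff_distrib)
    ultimately show ?thesis using that[of "u *\<^sub>R m"] nm delta by simp
  qed
  obtain w where w: "w < length ps" "dist (ps ! w) m' \<le> \<delta>" using point_near[OF m'(1)] .
  have near: "dist (ps ! w) z < r" if "dist m z \<le> 22/25 * r" for z
  proof -
    have "dist (ps ! w) z \<le> dist (ps ! w) m' + (dist m' m + dist m z)"
      by (meson add_left_mono dist_triangle order_trans)
    also have "\<dots> < r" using w(2) m'(2) that r r0 by simp
    finally show ?thesis .
  qed
  have "norm (ps ! w) \<le> norm m' + dist (ps ! w) m'"
    using norm_triangle_sub[of "ps ! w" m'] by (simp add: dist_norm)
  then have "norm (ps ! w) < norm (ps ! y)" using w(2) m'(3) by (simp add: Y_def)
  then have "w < y" using sorted[of y w] w(1) by (metis linorder_neqE_nat not_less order_less_irrefl)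
  then show ?thesis using that[of w] near mZ mY by (auto simp: Y_def)
qed

end

locale generic_points = dense_sorted_points +
  assumes distinct_distances: "distinct_distances ps"
begin

text \<open>For an edge, the lune contains a vertex. Otherwise let \<open>y\<close> be the first vertex of \<open>\<sigma>\<close> off its
  longest edge \<open>{a, b}\<close>. Either \<open>y\<close> is the first vertex that extends \<open>\<sigma> - {y}\<close> without
  increasing the entrance time, and \<open>\<sigma>\<close> is not the pivot of a cycle; or an earlier
  vertex does so. The earlier vertex is within distance \<open>r\<close> of \<open>y\<close>, or
  \<open>closer_vertex\<close> replaces it by one that is; either way \<open>\<sigma>\<close> gets an apparent coface.\<close>

lemma large_simplex_dichotomy:
  assumes k: "k \<ge> 1" and \<sigma>: "\<sigma> \<subseteq> {..<length ps}" "card \<sigma> = Suc k"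
    and r: "r = entrance_time ps \<sigma>" "30 * \<delta> \<le> r"
    and ab: "a \<in> \<sigma>" "b \<in> \<sigma>" "a \<noteq> b" "dist (ps ! a) (ps ! b) = r"
  shows "(\<exists>x<length ps. x \<notin> \<sigma> \<and> (\<forall>z\<in>\<sigma> - {a, b}. x < z) \<and> (\<forall>z\<in>\<sigma>. dist (ps ! x) (ps ! z) \<le> r)) \<or>
    (\<exists>y\<in>\<sigma> - {a, b}. \<forall>x<length ps. x \<notin> \<sigma> - {y} \<longrightarrow> (\<forall>z\<in>\<sigma> - {y}. dist (ps ! x) (ps ! z) \<le> r) \<longrightarrow> y \<le> x)"
    (is "?apparent \<or> ?nonpivot")
proof (cases "\<sigma> = {a, b}")
  case True
  obtain x where x: "x < length ps" "dist (ps ! x) (ps ! a) < r" "dist (ps ! x) (ps ! b) < r"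
    using vertex_in_lune[of a b r] ab r \<sigma>(1) by auto
  then have "x \<notin> {a, b}" using ab(4) by (auto simp: dist_commute)
  then have ?apparent using x True by auto
  then show ?thesis ..
next
  case False
  have fin: "finite \<sigma>" and ne: "\<sigma> \<noteq> {}" using \<sigma> ab by (auto intro: finite_subset)
  have \<sigma>dist: "\<forall>i\<in>\<sigma>. \<forall>j\<in>\<sigma>. dist (ps ! i) (ps ! j) \<le> r"
    using entrance_time_le_iff[OF ne \<sigma>(1), of r] r(1) by simp
  define y where "y = Min (\<sigma> - {a, b})"
  have "\<sigma> - {a, b} \<noteq> {}" using False ab by auto
  then have y: "y \<in> \<sigma> - {a, b}"
    using fin unfolding y_def by (intro Min_in) auto
  have ymin: "y \<le> z" if "z \<in> \<sigma> - {a, b}" for z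
    using fin that unfolding y_def by (intro Min_le) auto
  show ?thesis
  proof (cases ?nonpivot)
    case nonpivot: False
    then obtain x where x: "x < length ps" "x \<notin> \<sigma> - {y}" "x < y"
      and xd: "\<forall>z\<in>\<sigma> - {y}. dist (ps ! x) (ps ! z) \<le> r"
      using y by (meson not_le)
    have x\<sigma>: "x \<notin> \<sigma>" using x by auto
    have yl: "y < length ps" using y \<sigma>(1) by auto
    show ?thesis
    proof (cases "dist (ps ! x) (ps ! y) \<le> r")
      case True
      then have "\<forall>z\<in>\<sigma>. dist (ps ! x) (ps ! z) \<le> r" using xd by auto
      then have ?apparent using x x\<sigma> ymin by fastforce
      then show ?thesis ..
    next
      case far: False
      obtain w where w: "w < y" "\<And>z. z \<in> (!) ps ` (\<sigma> - {y}) \<Longrightarrow> dist (ps ! w) z < r"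
        "dist (ps ! w) (ps ! y) < r"
      proof (rule closer_vertex[of x y r "(!) ps ` (\<sigma> - {y})" "ps ! a" "ps ! b"])
        show "norm (ps ! x) \<le> norm (ps ! y)" using sorted x(3) yl by blast
      qed (use x yl far r xd \<sigma>dist y ab in auto)
      have wd: "dist (ps ! w) (ps ! z) < r" if "z \<in> \<sigma>" for z
        using w(2)[of "ps ! z"] w(3) that by (cases "z = y") auto
      have "w \<noteq> a" "w \<noteq> b" using wd[OF ab(1)] wd[OF ab(2)] ab(4) by (auto simp: dist_commute)
      then have "w \<notin> \<sigma>" using ymin[of w] w(1) by auto
      then have ?apparent using w(1) yl wd ymin by (intro disjI1 exI[of _ w]) (auto intro: less_imp_le less_le_trans)
      then show ?thesis ..
    qed
  qed simp
qed

text \<open>So above the scale \<open>30 * \<delta>\<close> a pivot always belongs to an apparent pair, and its column is an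
  unreduced column of the boundary matrix.\<close>

lemma large_pivot_column:
  assumes k: "k \<ge> 1" and i: "i < length (ordered_simplices ps (Suc k))"
    and v: "v = fst (reduce_cols (cols (vr_boundary_matrix ps k))) ! i" "\<not> is_zero_col v"
    and large: "30 * \<delta> \<le> entrance_time ps (ordered_simplices ps k ! low v)"
  shows "col_size v \<le> k + 2"
proof -
  define n where "n = length (ordered_simplices ps k)"
  define \<sigma> where "\<sigma> = ordered_simplices ps k ! low v"
  define r where "r = entrance_time ps \<sigma>"
  have r0: "r > 0" using large delta by (simp add: r_def \<sigma>_def)
  have vc: "v \<in> carrier_vec n"
    using reduce_cols_carrier[OF cols_vr_boundary_matrix_carrier[of ps k]] i
    by (auto simp: subset_iff v(1) n_def)
  have low: "low v \<in> nonzero_rows v" using v(2) by (rule low_in_nonzero_rows)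
  then have ln: "low v < n" using vc by (auto simp: nonzero_rows_def)
  have \<sigma>: "\<sigma> \<subseteq> {..<length ps}" "card \<sigma> = Suc k" "\<sigma> \<noteq> {}" "finite \<sigma>"
    using nth_ordered_simplices[of "low v" ps k] ln by (auto simp: \<sigma>_def n_def)
  obtain a b where ab: "a \<in> \<sigma>" "b \<in> \<sigma>" "dist (ps ! a) (ps ! b) = r"
    using entrance_time_attained[OF \<sigma>(3,1)] r_def by blast
  have "a \<noteq> b" using ab r0 by auto
  have cyc: "is_cycle ps k v" unfolding v(1) by (rule is_cycle_reduced[OF i])
  consider (apparent) x where "x < length ps" "x \<notin> \<sigma>" "\<forall>z\<in>\<sigma> - {a, b}. x < z"
      "\<forall>z\<in>\<sigma>. dist (ps ! x) (ps ! z) \<le> r"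
    | (nonpivot) y where "y \<in> \<sigma> - {a, b}"
      "\<forall>x<length ps. x \<notin> \<sigma> - {y} \<longrightarrow> (\<forall>z\<in>\<sigma> - {y}. dist (ps ! x) (ps ! z) \<le> r) \<longrightarrow> y \<le> x"
    using large_simplex_dichotomy[OF k \<sigma>(1,2) r_def _ ab(1,2) \<open>a \<noteq> b\<close> ab(3)] large
    unfolding r_def \<sigma>_def by blast
  then show ?thesis
  proof cases
    case apparent
    obtain t where t: "t < length (ordered_simplices ps (Suc k))"
      "\<not> is_zero_col (cols (vr_boundary_matrix ps k) ! t)"
      "low (cols (vr_boundary_matrix ps k) ! t) = low v"
      "\<And>t'. t' < t \<Longrightarrow> low v \<notin> nonzero_rows (cols (vr_boundary_matrix ps k) ! t')"
      using apparent_pair[OF distinct_distances ln[unfolded n_def] \<sigma>_def ab(1,2) \<open>a \<noteq> b\<close>, of x]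
        ab(3) apparent unfolding r_def by metis
    have "v = cols (vr_boundary_matrix ps k) ! t"
      unfolding v(1)
      by (rule apparent_pair_unreduced[OF i t(1,2) _ refl]) (use t v in auto)
    then show ?thesis using col_size_boundary_le[OF t(1)] by simp
  next
    case nonpivot
    have "\<sigma> - {y} \<subseteq> {..<length ps}" "a \<in> \<sigma> - {y}" "b \<in> \<sigma> - {y}" using \<sigma>(1) ab nonpivot by auto
    then have "r \<le> entrance_time ps (\<sigma> - {y})"
      using entrance_time_le_iff[of "\<sigma> - {y}" ps "entrance_time ps (\<sigma> - {y})"] ab(3) by fastforce
    moreover have "entrance_time ps (\<sigma> - {y}) \<le> r"
      using entrance_time_mono[of "\<sigma> - {y}" \<sigma> ps] \<sigma>(1) \<open>a \<in> \<sigma> - {y}\<close> by (auto simp: r_def)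
    ultimately have "entrance_time ps (\<sigma> - {y}) = entrance_time ps \<sigma>" by (simp add: r_def)
    then have False
      using not_pivot_of_cycle[OF vc[unfolded n_def] cyc v(2) \<sigma>_def, of y] nonpivot \<open>a \<in> \<sigma> - {y}\<close>
      unfolding r_def by blast
    then show ?thesis ..
  qed
qed

end

section \<open>Bounding the fill-in\<close>

text \<open>Pivots are distinct, so the sizes of the non-zero columns may be summed over their pivots.\<close>

lemma fill_in_le_sum_pivots:
  assumes f: "\<And>i. i < length (ordered_simplices ps (Suc k)) \<Longrightarrow>
      \<not> is_zero_col (fst (reduce_cols (cols (vr_boundary_matrix ps k))) ! i) \<Longrightarrow>
      col_size (fst (reduce_cols (cols (vr_boundary_matrix ps k))) ! i)
        \<le> f (ordered_simplices ps k ! low (fst (reduce_cols (cols (vr_boundary_matrix ps k))) ! i))"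
  shows "mat_size (reduced_matrix (vr_boundary_matrix ps k)) \<le> (\<Sum>\<sigma>\<in>vr_simplices ps k. f \<sigma>)"
proof -
  define D where "D = cols (vr_boundary_matrix ps k)"
  define R where "R = fst (reduce_cols D)"
  define rows where "rows = ordered_simplices ps k"
  define I where "I = {i. i < length D \<and> \<not> is_zero_col (R ! i)}"
  define g where "g i = rows ! low (R ! i)" for i
  have lenD: "length D = length (ordered_simplices ps (Suc k))" by (simp add: D_def)
  have carr: "set D \<subseteq> carrier_vec (length rows)"
    unfolding D_def rows_def by (rule cols_vr_boundary_matrix_carrier)
  have lowl: "low (R ! i) < length rows" if "i \<in> I" for i
  proof -
    have "R ! i \<in> carrier_vec (length rows)"
      using reduce_cols_carrier[OF carr] that by (auto simp: I_def R_def subset_iff)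
    then show ?thesis
      using low_in_nonzero_rows[of "R ! i"] that by (auto simp: I_def nonzero_rows_def)
  qed
  have inj: "inj_on g I"
  proof (rule inj_onI)
    fix i j assume ij: "i \<in> I" "j \<in> I" "g i = g j"
    have "low (R ! i) = low (R ! j)"
      using ij lowl distinct_ordered_simplices[of ps k] by (simp add: g_def rows_def nth_eq_iff_index_eq)
    then show "i = j"
      using reduce_cols_distinct_pivots[OF carr, of i j] ij by (auto simp: I_def R_def)
  qed
  have "mat_size (reduced_matrix (vr_boundary_matrix ps k)) = (\<Sum>i<length D. col_size (R ! i))"
    unfolding mat_size_reduced_matrix by (simp add: R_def D_def)
  also have "\<dots> = (\<Sum>i\<in>I. col_size (R ! i))"
    by (rule sum.mono_neutral_right) (auto simp: I_def col_size_def is_zero_col_iff)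
  also have "\<dots> \<le> (\<Sum>i\<in>I. f (g i))"
    by (rule sum_mono) (use f in \<open>auto simp: I_def g_def R_def D_def rows_def\<close>)
  also have "\<dots> = (\<Sum>\<sigma>\<in>g ` I. f \<sigma>)" by (simp add: sum.reindex[OF inj])
  also have "\<dots> \<le> (\<Sum>\<sigma>\<in>vr_simplices ps k. f \<sigma>)"
    by (rule sum_mono2[OF finite_vr_simplices])
       (use lowl nth_mem ordered_simplices(1)[of ps k] in \<open>force simp: g_def rows_def\<close>)+
  finally show ?thesis .
qed

lemma card_vr_simplices_le: "card (vr_simplices ps m) \<le> length ps ^ Suc m"
proof -
  have "card (vr_simplices ps m) = length ps choose Suc m"
    unfolding vr_simplices_eq using n_subsets[of "{..<length ps}" "Suc m"] by simp
  also have "\<dots> \<le> length ps ^ Suc m" by (cases "Suc m \<le> length ps") (simp_all add: binomial_le_pow binomial_eq_0 del: power_Suc)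
  finally show ?thesis .
qed

lemma col_size_le: "v \<in> carrier_vec n \<Longrightarrow> col_size v \<le> n"
  using card_mono[of "{..<n}" "nonzero_rows v"] by (auto simp: col_size_def nonzero_rows_def)

lemma fill_in_trivial_bound:
  "mat_size (reduced_matrix (vr_boundary_matrix ps k)) \<le> length ps ^ (2 * k + 2)"
proof -
  define N where "N = card (vr_simplices ps k)"
  have "mat_size (reduced_matrix (vr_boundary_matrix ps k)) \<le> (\<Sum>\<sigma>\<in>vr_simplices ps k. N)"
  proof (rule fill_in_le_sum_pivots)
    fix i assume "i < length (ordered_simplices ps (Suc k))"
    then have "fst (reduce_cols (cols (vr_boundary_matrix ps k))) ! i \<in> carrier_vec N"
      using reduce_cols_carrier[OF cols_vr_boundary_matrix_carrier[of ps k]]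
      by (auto simp: N_def length_ordered_simplices subset_iff)
    then show "col_size (fst (reduce_cols (cols (vr_boundary_matrix ps k))) ! i) \<le> N"
      by (rule col_size_le)
  qed
  also have "\<dots> = N * N" by (simp add: N_def)
  also have "\<dots> \<le> length ps ^ Suc k * length ps ^ Suc k"
    using card_vr_simplices_le[of ps k] by (intro mult_mono) (auto simp: N_def)
  also have "\<dots> = length ps ^ (2 * k + 2)" by (simp flip: power_add add: mult_2)
  finally show ?thesis .
qed

lemma cost_le_fill_in:
  "reduction_cost (vr_boundary_matrix ps k)
     \<le> length ps ^ (k + 2) * mat_size (reduced_matrix (vr_boundary_matrix ps k))"
proof -
  have "dim_col (vr_boundary_matrix ps k) \<le> length ps ^ (k + 2)"
    using card_vr_simplices_le[of ps "Suc k"] by (simp add: length_ordered_simplices)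
  then show ?thesis using reduction_cost_le[of "vr_boundary_matrix ps k"] by (meson le_trans mult_le_mono1)
qed

text \<open>A column whose pivot enters before \<open>30 * \<delta>\<close> contains only simplices that do so too; all
  others have at most \<open>k + 2\<close> entries.\<close>

lemma (in generic_points) fill_in_bound:
  assumes k: "k \<ge> 1"
  shows "mat_size (reduced_matrix (vr_boundary_matrix ps k))
    \<le> (k + 2) * length ps ^ Suc k + (card {\<sigma> \<in> vr_simplices ps k. entrance_time ps \<sigma> < 30 * \<delta>})\<^sup>2"
proof -
  define S where "S = {\<sigma> \<in> vr_simplices ps k. entrance_time ps \<sigma> < 30 * \<delta>}"
  define f where "f \<sigma> = (if \<sigma> \<in> S then card S else 0) + (k + 2)" for \<sigma>
  have finS: "finite S" by (simp add: S_def finite_vr_simplices)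
  have "mat_size (reduced_matrix (vr_boundary_matrix ps k)) \<le> (\<Sum>\<sigma>\<in>vr_simplices ps k. f \<sigma>)"
  proof (rule fill_in_le_sum_pivots)
    fix i assume i: "i < length (ordered_simplices ps (Suc k))"
    define v where "v = fst (reduce_cols (cols (vr_boundary_matrix ps k))) ! i"
    assume nz: "\<not> is_zero_col (fst (reduce_cols (cols (vr_boundary_matrix ps k))) ! i)"
    have vc: "v \<in> carrier_vec (length (ordered_simplices ps k))"
      using reduce_cols_carrier[OF cols_vr_boundary_matrix_carrier[of ps k]] i
      by (auto simp: v_def subset_iff)
    have lown: "low v < length (ordered_simplices ps k)"
      using low_in_nonzero_rows[of v] nz vc by (auto simp: nonzero_rows_def v_def)
    define \<sigma> where "\<sigma> = ordered_simplices ps k ! low v"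
    have \<sigma>: "\<sigma> \<in> vr_simplices ps k" using lown nth_mem ordered_simplices(1) by (metis \<sigma>_def)
    have "col_size v \<le> f \<sigma>"
    proof (cases "30 * \<delta> \<le> entrance_time ps \<sigma>")
      case True
      then show ?thesis
        using large_pivot_column[OF k i v_def] nz by (simp add: f_def v_def \<sigma>_def)
    next
      case False
      have "(!) (ordered_simplices ps k) ` nonzero_rows v \<subseteq> S"
      proof
        fix \<tau> assume "\<tau> \<in> (!) (ordered_simplices ps k) ` nonzero_rows v"
        then obtain r where r: "r \<in> nonzero_rows v" "\<tau> = ordered_simplices ps k ! r" by auto
        have rl: "r < length (ordered_simplices ps k)" using r vc by (auto simp: nonzero_rows_def)
        have "r = low v \<or> rho_lex_less ps \<tau> \<sigma>"
          using ordered_simplices_nth_less_iff[OF rl lown] nonzero_row_le_low[OF r(1)] r(2)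
          by (auto simp: \<sigma>_def)
        then have "entrance_time ps \<tau> \<le> entrance_time ps \<sigma>"
          using r(2) by (auto simp: \<sigma>_def dest: entrance_time_mono_rho)
        moreover have "\<tau> \<in> vr_simplices ps k" using rl r(2) nth_mem ordered_simplices(1) by metis
        ultimately show "\<tau> \<in> S" using False by (simp add: S_def)
      qed
      moreover have "inj_on ((!) (ordered_simplices ps k)) (nonzero_rows v)"
        by (rule inj_on_subset[OF inj_on_ordered_simplices]) (use vc in \<open>auto simp: nonzero_rows_def\<close>)
      ultimately have "col_size v \<le> card S"
        unfolding col_size_def using finS by (metis card_image card_mono)
      then show ?thesis using False \<sigma> by (simp add: f_def S_def)
    qed
    then show "col_size (fst (reduce_cols (cols (vr_boundary_matrix ps k))) ! i)
        \<le> f (ordered_simplices ps k ! low (fst (reduce_cols (cols (vr_boundary_matrix ps k))) ! i))"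
      by (simp add: v_def \<sigma>_def)
  qed
  also have "\<dots> = (\<Sum>\<sigma>\<in>vr_simplices ps k. if \<sigma> \<in> S then card S else 0) + (\<Sum>\<sigma>\<in>vr_simplices ps k. k + 2)"
    unfolding f_def by (rule sum.distrib)
  also have "(\<Sum>\<sigma>\<in>vr_simplices ps k. if \<sigma> \<in> S then card S else 0) = (\<Sum>\<sigma>\<in>S. card S)"
    by (rule sum.mono_neutral_cong_right) (auto simp: S_def finite_vr_simplices)
  also have "(\<Sum>\<sigma>\<in>S. card S) = (card S)\<^sup>2"
    by (simp add: power2_eq_square)
  also have "(\<Sum>\<sigma>\<in>vr_simplices ps k. k + 2) \<le> (k + 2) * length ps ^ Suc k"
    using mult_le_mono2[OF card_vr_simplices_le[of ps k], of "k + 2"] by (simp add: mult.commute)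
  finally show ?thesis by (simp add: S_def add.commute)
qed

section \<open>Uniform random points\<close>

lemma emeasure_lborel_equilateral_cbox:
  fixes a b :: "real ^ 'd"
  assumes "\<And>i. b $ i - a $ i = c" "0 \<le> c"
  shows "emeasure lborel (cbox a b) = ennreal (c ^ CARD('d))"
proof -
  have side: "(b - a) \<bullet> u = c" if u: "u \<in> Basis" for u
  proof -
    obtain i where "u = axis i 1" using u by (auto simp: Basis_vec_def)
    then show ?thesis using assms(1)[of i] by (simp add: inner_axis)
  qed
  then have "\<forall>u\<in>Basis. a \<bullet> u \<le> b \<bullet> u"
    using assms(2) by (metis diff_ge_0_iff_ge inner_diff_left)
  then show ?thesis
    using assms(2) by (simp add: emeasure_lborel_cbox_eq side DIM_cart)
qed

lemma emeasure_unit_cube: "emeasure lborel (unit_cube :: (real ^ 'd) set) = 1"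
  unfolding unit_cube_def by (subst emeasure_lborel_equilateral_cbox[of _ _ 1]) auto

lemma unit_cube_sets [measurable]: "unit_cube \<in> sets borel"
  by (simp add: unit_cube_def)

lemma convex_unit_cube: "convex unit_cube"
  by (simp add: unit_cube_def convex_box)

lemma mem_unit_cube: "(x :: real ^ 'd) \<in> unit_cube \<longleftrightarrow> (\<forall>i. - 1 / 2 \<le> x $ i \<and> x $ i \<le> 1 / 2)"
  by (simp add: unit_cube_def mem_box_cart)

locale uniform_sample = prob_space M for M :: "'w measure" +
  fixes n :: nat and X :: "nat \<Rightarrow> 'w \<Rightarrow> real ^ 'd"
  assumes iid: "iid_uniform_cube M n X"
begin

lemma indep: "indep_vars (\<lambda>_. borel) X {..<n}"
  and distr_X: "i < n \<Longrightarrow> distr M borel (X i) = uniform_measure lborel unit_cube"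
  using iid by (auto simp: iid_uniform_cube_def)

lemma X_measurable [measurable]: "i < n \<Longrightarrow> X i \<in> borel_measurable M"
  using indep by (auto simp: indep_vars_def)

lemma prob_X_in:
  assumes i: "i < n" and A [measurable]: "A \<in> sets borel"
  shows "prob {\<omega> \<in> space M. X i \<omega> \<in> A} = measure lborel (unit_cube \<inter> A)"
proof -
  have "prob {\<omega> \<in> space M. X i \<omega> \<in> A} = measure (distr M borel (X i)) A"
    using i by (subst measure_distr) (auto intro!: arg_cong[where f = prob])
  also have "\<dots> = measure lborel (unit_cube \<inter> A)"
    unfolding distr_X[OF i]
    by (subst measure_uniform_measure) (auto simp: emeasure_unit_cube measure_def)
  finally show ?thesis .
qed

lemma AE_X:
  assumes i: "i < n" and P: "Measurable.pred borel P" and ae: "AE x in lborel. x \<in> unit_cube \<longrightarrow> P x"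
  shows "AE \<omega> in M. P (X i \<omega>)"
proof -
  have "AE x in distr M borel (X i). P x"
    unfolding distr_X[OF i] using ae by (intro AE_uniform_measureI) simp_all
  then show ?thesis using i P by (subst (asm) AE_distr_iff) (auto simp: pred_def)
qed

lemma AE_in_unit_cube: "AE \<omega> in M. \<forall>i<n. X i \<omega> \<in> unit_cube"
proof -
  have "AE \<omega> in M. \<forall>i\<in>{..<n}. X i \<omega> \<in> unit_cube"
    by (intro AE_finite_allI) (auto intro!: AE_X)
  then show ?thesis by eventually_elim auto
qed

text \<open>By independence, moments of the number of points in \<open>A\<close> factor over the points. The
  exponential moment with base \<open>2\<close> controls large counts.\<close>

lemma expectation_prod_indicator:
  assumes A [measurable]: "A \<in> sets borel"
  shows "expectation (\<lambda>\<omega>. \<Prod>i<n. 1 + c * indicator A (X i \<omega>)) = (1 + c * measure lborel (unit_cube \<inter> A)) ^ n"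
    and "integrable M (\<lambda>\<omega>. \<Prod>i<n. 1 + c * indicator A (X i \<omega>) :: real)"
proof -
  have ind: "indep_vars (\<lambda>_. borel) (\<lambda>i \<omega>. 1 + c * indicator A (X i \<omega>) :: real) {..<n}"
    by (rule indep_vars_compose2[OF indep]) auto
  have int: "integrable M (\<lambda>\<omega>. indicator A (X i \<omega>) :: real)" if "i < n" for i
    using that by (intro integrable_const_bound[where B = 1]) (auto simp: indicator_def)
  have ex: "expectation (\<lambda>\<omega>. indicator A (X i \<omega>)) = measure lborel (unit_cube \<inter> A)" if "i < n" for i
  proof -
    have "expectation (\<lambda>\<omega>. indicator A (X i \<omega>)) = expectation (indicator {\<omega> \<in> space M. X i \<omega> \<in> A})"
      by (intro Bochner_Integration.integral_cong) (auto simp: indicator_def)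
    also have "\<dots> = prob {\<omega> \<in> space M. X i \<omega> \<in> A}" using that by simp
    finally show ?thesis using prob_X_in[OF that A] by simp
  qed
  show "integrable M (\<lambda>\<omega>. \<Prod>i<n. 1 + c * indicator A (X i \<omega>) :: real)"
    by (rule indep_vars_integrable[OF _ ind]) (use int in auto)
  have "expectation (\<lambda>\<omega>. \<Prod>i<n. 1 + c * indicator A (X i \<omega>))
      = (\<Prod>i<n. expectation (\<lambda>\<omega>. 1 + c * indicator A (X i \<omega>)))"
    by (rule indep_vars_lebesgue_integral[OF _ ind]) (use int in auto)
  also have "\<dots> = (\<Prod>i<n. 1 + c * measure lborel (unit_cube \<inter> A))"
    by (intro prod.cong) (use int ex in \<open>auto simp: prob_space\<close>)
  finally show "expectation (\<lambda>\<omega>. \<Prod>i<n. 1 + c * indicator A (X i \<omega>)) = (1 + c * measure lborel (unit_cube \<inter> A)) ^ n"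
    by simp
qed

lemma prob_all_miss:
  assumes A [measurable]: "A \<in> sets borel" and p: "measure lborel (unit_cube \<inter> A) = p"
  shows "prob {\<omega> \<in> space M. \<forall>i<n. X i \<omega> \<notin> A} \<le> exp (- (real n * p))"
proof -
  have "prob {\<omega> \<in> space M. \<forall>i<n. X i \<omega> \<notin> A} = expectation (indicator {\<omega> \<in> space M. \<forall>i<n. X i \<omega> \<notin> A})"
    by simp
  also have "\<dots> = expectation (\<lambda>\<omega>. \<Prod>i<n. 1 + (-1) * indicator A (X i \<omega>))"
  proof (intro Bochner_Integration.integral_cong refl)
    fix \<omega> assume "\<omega> \<in> space M"
    then show "indicator {\<omega> \<in> space M. \<forall>i<n. X i \<omega> \<notin> A} \<omega> = (\<Prod>i<n. 1 + (-1) * indicator A (X i \<omega>) :: real)"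
      by (cases "\<forall>i<n. X i \<omega> \<notin> A") (auto simp: indicator_def intro!: prod_zero[symmetric])
  qed
  also have "\<dots> = (1 - p) ^ n"
    using expectation_prod_indicator(1)[OF A, of "-1"] p by simp
  also have "\<dots> \<le> exp (- p) ^ n"
  proof (rule power_mono)
    have "p \<le> measure lborel (unit_cube :: (real ^ 'd) set)"
      unfolding p[symmetric] by (rule measure_mono_fmeasurable) (auto simp: fmeasurable_def emeasure_unit_cube)
    then show "0 \<le> 1 - p" by (simp add: measure_def emeasure_unit_cube)
    show "1 - p \<le> exp (- p)" using exp_ge_add_one_self[of "-p"] by simp
  qed
  also have "\<dots> = exp (- (real n * p))" by (simp flip: exp_of_nat_mult)
  finally show ?thesis .
qed

lemma prob_many_hits:
  assumes A [measurable]: "A \<in> sets borel" and p: "measure lborel (unit_cube \<inter> A) \<le> p"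
  shows "prob {\<omega> \<in> space M. K \<le> card {i. i < n \<and> X i \<omega> \<in> A}} \<le> exp (real n * p) / 2 ^ K"
proof -
  define u where "u \<omega> = (\<Prod>i<n. 1 + 1 * indicator A (X i \<omega>) :: real)" for \<omega>
  have u: "u \<omega> = 2 ^ card {i. i < n \<and> X i \<omega> \<in> A}" for \<omega>
  proof -
    have "u \<omega> = (\<Prod>i<n. if X i \<omega> \<in> A then 2 else 1)"
      unfolding u_def by (intro prod.cong) (auto simp: indicator_def)
    also have "\<dots> = (\<Prod>i\<in>{i. i < n \<and> X i \<omega> \<in> A}. 2)"
      by (rule prod.mono_neutral_cong_right) auto
    finally show ?thesis by simp
  qed
  have "{\<omega> \<in> space M. K \<le> card {i. i < n \<and> X i \<omega> \<in> A}} = {\<omega> \<in> space M. 2 ^ K \<le> u \<omega>}"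
    by (simp add: u)
  also have "prob \<dots> \<le> expectation u / 2 ^ K"
    using expectation_prod_indicator(2)[OF A, of 1] unfolding u_def[abs_def]
    by (intro integral_Markov_inequality_measure[where A = "space M"]) (auto intro!: AE_I2 prod_nonneg)
  also have "expectation u = (1 + measure lborel (unit_cube \<inter> A)) ^ n"
    using expectation_prod_indicator(1)[OF A, of 1] by (simp add: u_def[abs_def])
  also have "\<dots> / 2 ^ K \<le> exp p ^ n / 2 ^ K"
  proof (intro divide_right_mono power_mono)
    show "1 + measure lborel (unit_cube \<inter> A) \<le> exp p"
      using p exp_ge_add_one_self[of p] by linarith
  qed auto
  also have "exp p ^ n = exp (real n * p)" by (simp flip: exp_of_nat_mult)
  finally show ?thesis .
qed

text \<open>Given the other points, \<open>X a\<close> would have to lie on a fixed sphere, a null set.\<close>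

lemma AE_dist_neq:
  assumes "a < n" "b < n" "c < n" "e < n" "a \<notin> {b, c, e}"
  shows "AE \<omega> in M. dist (X a \<omega>) (X b \<omega>) \<noteq> dist (X c \<omega>) (X e \<omega>)"
proof -
  define J where "J = {b, c, e}"
  define Y where "Y \<omega> = restrict (\<lambda>i. X i \<omega>) J" for \<omega>
  define PJ where "PJ = (PiM J (\<lambda>_. borel) :: (nat \<Rightarrow> real ^ 'd) measure)"
  define Z where "Z \<omega> = restrict (\<lambda>i. X i \<omega>) {a}" for \<omega>
  define PA where "PA = (PiM {a} (\<lambda>_. borel) :: (nat \<Rightarrow> real ^ 'd) measure)"
  define Q where "Q = (\<lambda>(y, x). dist (x a) (y b) \<noteq> dist (y c) (y e :: real ^ 'd))"
  have J: "J \<subseteq> {..<n}" "J \<inter> {a} = {}" "{a} \<subseteq> {..<n}" using assms by (auto simp: J_def)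
  have ind: "indep_var PJ Y PA Z"
    unfolding PJ_def PA_def Y_def[abs_def] Z_def[abs_def]
    by (rule indep_var_restrict[OF indep J(2) J(1) J(3)])
  have Ym [measurable]: "Y \<in> measurable M PJ" using indep_var_rv1[OF ind] .
  have Zm [measurable]: "Z \<in> measurable M PA" using indep_var_rv2[OF ind] .
  interpret Y: prob_space "distr M PJ Y" by (rule prob_space_distr) fact
  interpret Z: prob_space "distr M PA Z" by (rule prob_space_distr) fact
  interpret YZ: pair_prob_space "distr M PJ Y" "distr M PA Z" ..
  have comp: "(\<lambda>p. fst p j) \<in> borel_measurable (PJ \<Otimes>\<^sub>M PA)" if "j \<in> J" for j
    unfolding PJ_def by (rule measurable_compose[OF measurable_fst measurable_component_singleton[OF that]])
  have compa: "(\<lambda>p. snd p a) \<in> borel_measurable (PJ \<Otimes>\<^sub>M PA)"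
    unfolding PA_def by (rule measurable_compose[OF measurable_snd measurable_component_singleton]) simp
  have Qm: "Measurable.pred (PJ \<Otimes>\<^sub>M PA) Q"
    unfolding Q_def case_prod_beta using comp[of b] comp[of c] comp[of e] compa by (simp add: J_def)
  have "AE p in distr M PJ Y \<Otimes>\<^sub>M distr M PA Z. Q p"
  proof (rule YZ.AE_pair_measure)
    show "{p \<in> space (distr M PJ Y \<Otimes>\<^sub>M distr M PA Z). Q p} \<in> sets (distr M PJ Y \<Otimes>\<^sub>M distr M PA Z)"
      using Qm by (simp add: pred_def space_pair_measure cong: sets_pair_measure_cong)
    have "AE x in distr M PA Z. dist (x a) (y b) \<noteq> dist (y c) (y e)" for y :: "nat \<Rightarrow> real ^ 'd"
    proof -
      have "sphere (y b) (dist (y c) (y e)) \<in> null_sets lebesgue"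
        using negligible_sphere negligible_iff_null_sets by blast
      then have "sphere (y b) (dist (y c) (y e)) \<in> null_sets lborel"
        using null_sets_completion_iff[of "sphere (y b) (dist (y c) (y e))" lborel] by auto
      then have "AE x in lborel. x \<notin> sphere (y b) (dist (y c) (y e))" by (rule AE_not_in)
      then have "AE x in lborel. x \<in> unit_cube \<longrightarrow> dist x (y b) \<noteq> dist (y c) (y e)"
        by eventually_elim (auto simp: dist_commute)
      then have "AE \<omega> in M. dist (X a \<omega>) (y b) \<noteq> dist (y c) (y e)"
        by (intro AE_X[OF assms(1)]) auto
      then have "AE \<omega> in M. dist (Z \<omega> a) (y b) \<noteq> dist (y c) (y e)"
        by (simp add: Z_def)
      moreover have "(\<lambda>x. x a) \<in> borel_measurable PA"
        unfolding PA_def by (rule measurable_component_singleton) simp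
      ultimately show ?thesis
        by (subst AE_distr_iff) auto
    qed
    then show "AE y in distr M PJ Y. AE x in distr M PA Z. Q (y, x)"
      by (simp add: Q_def)
  qed
  also have "distr M PJ Y \<Otimes>\<^sub>M distr M PA Z = distr M (PJ \<Otimes>\<^sub>M PA) (\<lambda>\<omega>. (Y \<omega>, Z \<omega>))"
    using ind by (simp add: indep_var_distribution_eq)
  finally have "AE \<omega> in M. Q (Y \<omega>, Z \<omega>)"
    using Qm by (subst (asm) AE_distr_iff) (auto simp: pred_def)
  then show ?thesis by eventually_elim (simp add: Q_def Y_def Z_def J_def)
qed

lemma AE_distinct_distances:
  "AE \<omega> in M. \<forall>i j k l. i < n \<longrightarrow> j < n \<longrightarrow> k < n \<longrightarrow> l < n \<longrightarrow> i \<noteq> j \<longrightarrow> k \<noteq> l \<longrightarrow>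
     dist (X i \<omega>) (X j \<omega>) = dist (X k \<omega>) (X l \<omega>) \<longrightarrow> {i, j} = {k, l}"
proof -
  define T where "T = {(a, b, c, e). a < n \<and> b < n \<and> c < n \<and> e < n \<and> a \<notin> {b, c, e}}"
  have "finite T"
    by (rule finite_subset[of _ "{..<n} \<times> {..<n} \<times> {..<n} \<times> {..<n}"]) (auto simp: T_def)
  then have "AE \<omega> in M. \<forall>(a, b, c, e)\<in>T. dist (X a \<omega>) (X b \<omega>) \<noteq> dist (X c \<omega>) (X e \<omega>)"
    by (intro AE_finite_allI) (auto simp: T_def intro!: AE_dist_neq)
  then show ?thesis
  proof eventually_elim
    fix \<omega> assume *: "\<forall>(a, b, c, e)\<in>T. dist (X a \<omega>) (X b \<omega>) \<noteq> dist (X c \<omega>) (X e \<omega>)"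
    show "\<forall>i j k l. i < n \<longrightarrow> j < n \<longrightarrow> k < n \<longrightarrow> l < n \<longrightarrow> i \<noteq> j \<longrightarrow> k \<noteq> l \<longrightarrow>
      dist (X i \<omega>) (X j \<omega>) = dist (X k \<omega>) (X l \<omega>) \<longrightarrow> {i, j} = {k, l}"
    proof (intro allI impI, rule ccontr)
      fix i j k l
      assume b: "i < n" "j < n" "k < n" "l < n" "i \<noteq> j" "k \<noteq> l"
        and eq: "dist (X i \<omega>) (X j \<omega>) = dist (X k \<omega>) (X l \<omega>)" and ne: "{i, j} \<noteq> {k, l}"
      \<comment> \<open>two different pairs: one of them has a vertex that is not in the other\<close>
      have "i \<notin> {k, l} \<or> j \<notin> {k, l}" using b ne by auto
      then show False
      proof
        assume "i \<notin> {k, l}"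
        then have "(i, j, k, l) \<in> T" using b by (auto simp: T_def)
        then show False using * eq by blast
      next
        assume "j \<notin> {k, l}"
        then have "(j, i, k, l) \<in> T" using b by (auto simp: T_def)
        then show False using * eq by (auto simp: dist_commute)
      qed
    qed
  qed
qed

end

section \<open>The sample as a sorted list\<close>

lemma mset_sorted_sample: "mset (sorted_sample n X \<omega>) = mset (map (\<lambda>i. X i \<omega>) [0..<n])"
  by (simp add: sorted_sample_def)

lemma length_sorted_sample [simp]: "length (sorted_sample n X \<omega>) = n"
  by (simp add: sorted_sample_def)

lemma set_sorted_sample: "set (sorted_sample n X \<omega>) = (\<lambda>i. X i \<omega>) ` {..<n}"
  using mset_eq_setD[OF mset_sorted_sample[of n X \<omega>]] by (simp add: atLeast0LessThan)

lemma norm_sorted_sample_mono: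
  assumes "i < j" "j < n"
  shows "norm (sorted_sample n X \<omega> ! i) \<le> norm (sorted_sample n X \<omega> ! j)"
proof -
  have "sorted (map norm (sorted_sample n X \<omega>))" by (simp add: sorted_sample_def)
  then show ?thesis using sorted_nth_mono[of "map norm (sorted_sample n X \<omega>)" i j] assms by simp
qed

lemma card_sorted_sample_in:
  "card {i. i < n \<and> sorted_sample n X \<omega> ! i \<in> A} = card {i. i < n \<and> X i \<omega> \<in> A}"
proof -
  have "length (filter (\<lambda>x. x \<in> A) (sorted_sample n X \<omega>)) = length (filter (\<lambda>x. x \<in> A) (map (\<lambda>i. X i \<omega>) [0..<n]))"
    using arg_cong[OF mset_sorted_sample, of "\<lambda>m. size (filter_mset (\<lambda>x. x \<in> A) m)"]
    by (simp flip: mset_filter size_mset del: mset_map)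
  also have "\<dots> = card {i. i < n \<and> X i \<omega> \<in> A}"
    by (simp add: length_filter_conv_card del: filter_map cong: conj_cong)
  finally show ?thesis by (simp add: length_filter_conv_card)
qed

lemma distinct_distances_sorted_sample:
  assumes "\<And>i j k l. i < n \<Longrightarrow> j < n \<Longrightarrow> k < n \<Longrightarrow> l < n \<Longrightarrow> i \<noteq> j \<Longrightarrow> k \<noteq> l \<Longrightarrow>
     dist (X i \<omega>) (X j \<omega>) = dist (X k \<omega>) (X l \<omega>) \<Longrightarrow> {i, j} = {k, l}"
  shows "distinct_distances (sorted_sample n X \<omega>)"
proof -
  obtain f where f: "f permutes {..<n}" "sorted_sample n X \<omega> = permute_list f (map (\<lambda>i. X i \<omega>) [0..<n])"
    by (rule mset_eq_permutation[OF mset_sorted_sample[of n X \<omega>]]) simp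
  have fn: "f i < n" if "i < n" for i using permutes_in_image[OF f(1), of i] that by simp
  have nth: "sorted_sample n X \<omega> ! i = X (f i) \<omega>" if "i < n" for i
    unfolding f(2) using that fn[OF that] f(1) by (subst permute_list_nth) simp_all
  have inj: "f i = f j \<longleftrightarrow> i = j" for i j by (rule inj_eq[OF permutes_inj[OF f(1)]])
  show ?thesis
    unfolding distinct_distances_def length_sorted_sample
  proof (intro allI impI)
    fix i j k l assume b: "i < j" "j < n" "k < l" "l < n"
      and "dist (sorted_sample n X \<omega> ! i) (sorted_sample n X \<omega> ! j)
        = dist (sorted_sample n X \<omega> ! k) (sorted_sample n X \<omega> ! l)"
    then have "dist (X (f i) \<omega>) (X (f j) \<omega>) = dist (X (f k) \<omega>) (X (f l) \<omega>)"
      by (simp add: nth)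
    then have "{f i, f j} = {f k, f l}"
      by (intro assms) (use b fn inj in auto)
    then show "i = k \<and> j = l" using b inj by (auto simp: doubleton_eq_iff)
  qed
qed

section \<open>A grid on the cube\<close>

text \<open>The cell with index \<open>c\<close> of the subdivision into \<open>N ^ CARD('d)\<close> cubes, enlarged by \<open>s\<close> cell
  widths on each side.\<close>

definition grid_cell :: "nat \<Rightarrow> real \<Rightarrow> ('d \<Rightarrow> nat) \<Rightarrow> (real ^ 'd) set" where
  "grid_cell N s c =
     cbox (\<chi> i. - 1 / 2 + (real (c i) - s) / real N) (\<chi> i. - 1 / 2 + (real (c i) + 1 + s) / real N)"

lemma grid_cell_sets [measurable]: "grid_cell N s c \<in> sets borel"
  by (simp add: grid_cell_def)

lemma mem_grid_cell: "x \<in> grid_cell N s c \<longleftrightarrow>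
    (\<forall>i. - 1 / 2 + (real (c i) - s) / real N \<le> x $ i \<and> x $ i \<le> - 1 / 2 + (real (c i) + 1 + s) / real N)"
  by (simp add: grid_cell_def mem_box_cart)

lemma emeasure_grid_cell:
  assumes "s \<ge> 0"
  shows "emeasure lborel (grid_cell N s c :: (real ^ 'd) set) = ennreal (((1 + 2 * s) / real N) ^ CARD('d))"
  unfolding grid_cell_def
  by (rule emeasure_lborel_equilateral_cbox) (use assms in \<open>auto simp: diff_divide_distrib add_divide_distrib\<close>)

lemma measure_grid_cell_le:
  assumes "s \<ge> 0"
  shows "measure lborel (unit_cube \<inter> (grid_cell N s c :: (real ^ 'd) set)) \<le> ((1 + 2 * s) / real N) ^ CARD('d)"
proof -
  have "measure lborel (unit_cube \<inter> (grid_cell N s c :: (real ^ 'd) set)) \<le> measure lborel (grid_cell N s c :: (real ^ 'd) set)"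
    by (rule measure_mono_fmeasurable) (auto simp: fmeasurable_def emeasure_grid_cell[OF assms])
  also have "\<dots> = ((1 + 2 * s) / real N) ^ CARD('d)"
    using assms by (simp add: measure_def emeasure_grid_cell)
  finally show ?thesis .
qed

lemma measure_grid_cell:
  assumes "\<And>i. c i < N"
  shows "measure lborel (unit_cube \<inter> (grid_cell N 0 c :: (real ^ 'd) set)) = (1 / real N) ^ CARD('d)"
proof -
  have "N > 0" using assms[of undefined] by simp
  have "grid_cell N 0 c \<subseteq> (unit_cube :: (real ^ 'd) set)"
  proof
    fix x :: "real ^ 'd" assume x: "x \<in> grid_cell N 0 c"
    show "x \<in> unit_cube"
      unfolding mem_unit_cube
    proof
      fix i
      have "(real (c i) + 1) / real N \<le> 1" using assms[of i] by (simp add: field_simps)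
      moreover have "0 \<le> real (c i) / real N" by simp
      moreover have "- 1 / 2 + real (c i) / real N \<le> x $ i" "x $ i \<le> - 1 / 2 + (real (c i) + 1) / real N"
        using x by (simp_all add: mem_grid_cell)
      ultimately show "- 1 / 2 \<le> x $ i \<and> x $ i \<le> 1 / 2" by linarith
    qed
  qed
  then have "unit_cube \<inter> grid_cell N 0 c = (grid_cell N 0 c :: (real ^ 'd) set)" by blast
  then show ?thesis by (simp add: measure_def emeasure_grid_cell)
qed

lemma grid_cells_cover:
  assumes x: "x \<in> (unit_cube :: (real ^ 'd) set)" and N: "N > 0"
  obtains c where "\<And>i. c i < N" "x \<in> grid_cell N 0 c"
proof -
  define y where "y i = real N * (x $ i + 1 / 2)" for i
  have y: "0 \<le> y i" "y i \<le> real N" for i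
  proof -
    have xi: "- 1 / 2 \<le> x $ i" "x $ i \<le> 1 / 2" using x by (simp_all add: mem_unit_cube)
    then show "0 \<le> y i" by (simp add: y_def)
    have "real N * (x $ i + 1 / 2) \<le> real N * 1" using xi by (intro mult_left_mono) auto
    then show "y i \<le> real N" by (simp add: y_def)
  qed
  \<comment> \<open>the face where a coordinate is \<open>1 / 2\<close> belongs to the last cell\<close>
  define c where "c i = (if y i = real N then N - 1 else nat \<lfloor>y i\<rfloor>)" for i
  have c: "c i < N \<and> real (c i) \<le> y i \<and> y i \<le> real (c i) + 1" for i
  proof (cases "y i = real N")
    case True
    then show ?thesis using N by (simp add: c_def of_nat_diff)
  next
    case False
    then have "y i < real N" using y[of i] by simp
    moreover have "real (nat \<lfloor>y i\<rfloor>) \<le> y i" using y(1)[of i] by simp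
    moreover have "y i \<le> real (nat \<lfloor>y i\<rfloor>) + 1" using real_of_int_floor_add_one_ge[of "y i"] by linarith
    ultimately show ?thesis using False by (simp add: c_def)
  qed
  have "x \<in> grid_cell N 0 c"
    unfolding mem_grid_cell
  proof
    fix i
    have "x $ i = - 1 / 2 + y i / real N" using N by (simp add: y_def)
    then show "- 1 / 2 + (real (c i) - 0) / real N \<le> x $ i \<and> x $ i \<le> - 1 / 2 + (real (c i) + 1 + 0) / real N"
      using c[of i] by (simp add: divide_right_mono)
  qed
  then show ?thesis using that c by blast
qed

lemma dist_in_grid_cell_le:
  assumes "x \<in> (grid_cell N 0 c :: (real ^ 'd) set)" "y \<in> grid_cell N 0 c"
  shows "dist x y \<le> real CARD('d) / real N"
proof -
  have comp: "\<bar>(x - y) $ i\<bar> \<le> 1 / real N" for i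
  proof -
    have "- 1 / 2 + real (c i) / real N \<le> z $ i \<and> z $ i \<le> - 1 / 2 + real (c i) / real N + 1 / real N"
      if "z \<in> {x, y}" for z
    proof -
      have "- 1 / 2 + (real (c i) - 0) / real N \<le> z $ i" "z $ i \<le> - 1 / 2 + (real (c i) + 1 + 0) / real N"
        using assms that unfolding mem_grid_cell by blast+
      then show ?thesis by (simp add: add_divide_distrib)
    qed
    from this[of x] this[of y] show ?thesis by (simp add: abs_le_iff)
  qed
  have "dist x y \<le> (\<Sum>i\<in>UNIV. \<bar>(x - y) $ i\<bar>)" unfolding dist_norm by (rule norm_le_l1_cart)
  also have "\<dots> \<le> (\<Sum>i\<in>(UNIV :: 'd set). 1 / real N)" by (rule sum_mono) (rule comp)
  finally show ?thesis by simp
qed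

lemma grid_cell_enlarge:
  assumes x: "x \<in> (grid_cell N 0 c :: (real ^ 'd) set)" and xy: "dist x y \<le> s / real N"
  shows "y \<in> grid_cell N s c"
  unfolding mem_grid_cell
proof
  fix i
  have "\<bar>(x - y) $ i\<bar> \<le> s / real N" using xy component_le_norm_cart[of "x - y" i] by (simp add: dist_norm)
  then have "x $ i - y $ i \<le> s / real N" "y $ i - x $ i \<le> s / real N" by auto
  moreover have "- 1 / 2 + real (c i) / real N \<le> x $ i" "x $ i \<le> - 1 / 2 + (real (c i) + 1) / real N"
    using x by (auto simp: mem_grid_cell)
  ultimately show "- 1 / 2 + (real (c i) - s) / real N \<le> y $ i \<and> y $ i \<le> - 1 / 2 + (real (c i) + 1 + s) / real N"
    by (simp add: add_divide_distrib diff_divide_distrib)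
qed

lemma grid_indices: "finite {c :: 'd::finite \<Rightarrow> nat. \<forall>i. c i < N}" "card {c :: 'd::finite \<Rightarrow> nat. \<forall>i. c i < N} = N ^ CARD('d)"
proof -
  have *: "{c :: 'd \<Rightarrow> nat. \<forall>i. c i < N} = PiE UNIV (\<lambda>_. {..<N})" by (auto simp: PiE_UNIV_domain)
  show "finite {c :: 'd \<Rightarrow> nat. \<forall>i. c i < N}" unfolding * by (rule finite_PiE) auto
  show "card {c :: 'd \<Rightarrow> nat. \<forall>i. c i < N} = N ^ CARD('d)" unfolding * by (simp add: card_PiE)
qed

section \<open>The fill-in of an evenly spread sample\<close>

text \<open>A simplex of diameter less than \<open>r\<close> consists of one of its vertices and \<open>k\<close> points near it.\<close>

lemma card_small_simplices_le:
  assumes K: "\<And>i. i < length ps \<Longrightarrow> card {j. j < length ps \<and> dist (ps ! i) (ps ! j) < r} \<le> K"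
  shows "card {\<sigma> \<in> vr_simplices ps k. entrance_time ps \<sigma> < r} \<le> length ps * K ^ k"
proof -
  define nb where "nb i = {j. j < length ps \<and> dist (ps ! i) (ps ! j) < r}" for i
  have fin: "finite (nb i)" for i by (simp add: nb_def)
  define T where "T i = {\<tau>. \<tau> \<subseteq> nb i \<and> card \<tau> = k}" for i
  have finT: "finite (T i)" for i by (rule finite_subset[of _ "Pow (nb i)"]) (auto simp: T_def fin)
  have cardT: "card (T i) \<le> K ^ k" if "i < length ps" for i
  proof -
    have "card (T i) = card (nb i) choose k" unfolding T_def by (rule n_subsets[OF fin])
    also have "\<dots> \<le> card (nb i) ^ k"
      by (cases "k \<le> card (nb i)") (simp_all add: binomial_le_pow binomial_eq_0)
    also have "\<dots> \<le> K ^ k" using K[OF that] by (intro power_mono) (auto simp: nb_def)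
    finally show ?thesis .
  qed
  have "{\<sigma> \<in> vr_simplices ps k. entrance_time ps \<sigma> < r} \<subseteq> (\<Union>i<length ps. insert i ` T i)"
  proof
    fix \<sigma> assume "\<sigma> \<in> {\<sigma> \<in> vr_simplices ps k. entrance_time ps \<sigma> < r}"
    then have \<sigma>: "\<sigma> \<subseteq> {..<length ps}" "card \<sigma> = Suc k" "entrance_time ps \<sigma> < r"
      by (auto simp: vr_simplices_eq)
    then have ne: "\<sigma> \<noteq> {}" by auto
    then obtain i where i: "i \<in> \<sigma>" by blast
    have "dist (ps ! i) (ps ! j) < r" if "j \<in> \<sigma>" for j
      using entrance_time_le_iff[OF ne \<sigma>(1), of "entrance_time ps \<sigma>"] i that \<sigma>(3) by fastforce
    then have "\<sigma> - {i} \<subseteq> nb i" using \<sigma>(1) by (auto simp: nb_def)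
    moreover have "card (\<sigma> - {i}) = k" using \<sigma>(2) i by simp
    ultimately have "\<sigma> - {i} \<in> T i" by (simp add: T_def)
    moreover have "\<sigma> = insert i (\<sigma> - {i})" using i by auto
    moreover have "i < length ps" using i \<sigma>(1) by auto
    ultimately show "\<sigma> \<in> (\<Union>i<length ps. insert i ` T i)" by blast
  qed
  then have "card {\<sigma> \<in> vr_simplices ps k. entrance_time ps \<sigma> < r} \<le> card (\<Union>i<length ps. insert i ` T i)"
    by (rule card_mono[rotated]) (use finT in auto)
  also have "\<dots> \<le> (\<Sum>i<length ps. card (insert i ` T i))" by (rule card_UN_le) simp
  also have "\<dots> \<le> (\<Sum>i<length ps. K ^ k)"
    by (rule sum_mono) (use cardT card_image_le[OF finT] le_trans in blast)
  finally show ?thesis by simp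
qed

lemma fill_in_evenly_spread:
  fixes ps :: "(real ^ 'd) list"
  assumes k: "k \<ge> 1" and N: "N > 0"
    and sorted: "\<And>i j. i < j \<Longrightarrow> j < length ps \<Longrightarrow> norm (ps ! i) \<le> norm (ps ! j)"
    and cube: "set ps \<subseteq> unit_cube" and dd: "distinct_distances ps"
    and hit: "\<And>c. (\<And>i. c i < N) \<Longrightarrow> \<exists>p\<in>set ps. p \<in> grid_cell N 0 c"
    and few: "\<And>c. (\<And>i. c i < N) \<Longrightarrow>
      card {i. i < length ps \<and> ps ! i \<in> grid_cell N (30 * real CARD('d)) c} \<le> K"
  shows "mat_size (reduced_matrix (vr_boundary_matrix ps k))
    \<le> (k + 2) * length ps ^ Suc k + (length ps * K ^ k)\<^sup>2"
proof -
  define \<delta> where "\<delta> = real CARD('d) / real N"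
  have r: "30 * \<delta> = 30 * real CARD('d) / real N" by (simp add: \<delta>_def)
  interpret generic_points ps unit_cube \<delta>
  proof
    show "norm (ps ! i) \<le> norm (ps ! j)" if "i < j" "j < length ps" for i j using sorted that .
    show "convex (unit_cube :: (real ^ 'd) set)" by (rule convex_unit_cube)
    show "0 \<in> (unit_cube :: (real ^ 'd) set)" by (simp add: mem_unit_cube)
    show "\<exists>p\<in>set ps. dist p z \<le> \<delta>" if "z \<in> unit_cube" for z
    proof -
      obtain c where c: "\<And>i. c i < N" "z \<in> grid_cell N 0 c" using grid_cells_cover[OF \<open>z \<in> unit_cube\<close> N] by blast
      then obtain p where "p \<in> set ps" "p \<in> grid_cell N 0 c" using hit by blast
      then show ?thesis using dist_in_grid_cell_le[of p N c z] c(2) by (auto simp: \<delta>_def)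
    qed
  qed (use cube dd N in \<open>auto simp: \<delta>_def\<close>)
  have "card {\<sigma> \<in> vr_simplices ps k. entrance_time ps \<sigma> < 30 * \<delta>} \<le> length ps * K ^ k"
  proof (rule card_small_simplices_le)
    fix i assume i: "i < length ps"
    then have "ps ! i \<in> unit_cube" by (rule nth_in_K)
    then obtain c where c: "\<And>i. c i < N" "ps ! i \<in> grid_cell N 0 c" using grid_cells_cover[OF _ N] by blast
    have "{j. j < length ps \<and> dist (ps ! i) (ps ! j) < 30 * \<delta>}
      \<subseteq> {j. j < length ps \<and> ps ! j \<in> grid_cell N (30 * real CARD('d)) c}"
      using grid_cell_enlarge[OF c(2)] by (auto simp: r less_imp_le)
    then have "card {j. j < length ps \<and> dist (ps ! i) (ps ! j) < 30 * \<delta>}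
      \<le> card {j. j < length ps \<and> ps ! j \<in> grid_cell N (30 * real CARD('d)) c}"
      by (rule card_mono[rotated]) simp
    also have "\<dots> \<le> K" by (rule few[OF c(1)])
    finally show "card {j. j < length ps \<and> dist (ps ! i) (ps ! j) < 30 * \<delta>} \<le> K" .
  qed
  then have "(card {\<sigma> \<in> vr_simplices ps k. entrance_time ps \<sigma> < 30 * \<delta>})\<^sup>2 \<le> (length ps * K ^ k)\<^sup>2"
    by (rule power_mono) simp
  then show ?thesis using fill_in_bound[OF k] by linarith
qed

section \<open>Measurability\<close>

text \<open>Which point ends up at a given position depends on the comparisons made by insertion sort, each
  of which is a measurable event.\<close>

lemma measurable_insort_nth:
  fixes Z :: "'w \<Rightarrow> 'b::{real_normed_vector, second_countable_topology}"
  assumes "Z \<in> borel_measurable M" "\<And>i. i < m \<Longrightarrow> (\<lambda>\<omega>. Y \<omega> ! i) \<in> borel_measurable M"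
    and "\<And>\<omega>. length (Y \<omega>) = m" "j \<le> m"
  shows "(\<lambda>\<omega>. insort_key norm (Z \<omega>) (Y \<omega>) ! j) \<in> borel_measurable M"
  using assms(2-)
proof (induction m arbitrary: Y j)
  case 0
  then have "Y = (\<lambda>\<omega>. [])" by auto
  then show ?case using 0 assms(1) by simp
next
  case (Suc m)
  note [measurable] = assms(1)
  have Y0 [measurable]: "(\<lambda>\<omega>. Y \<omega> ! 0) \<in> borel_measurable M" using Suc.prems(1)[of 0] by simp
  have ins: "insort_key norm (Z \<omega>) (Y \<omega>) =
      (if norm (Z \<omega>) \<le> norm (Y \<omega> ! 0) then Z \<omega> # Y \<omega> else Y \<omega> ! 0 # insort_key norm (Z \<omega>) (tl (Y \<omega>)))" for \<omega>
    using Suc.prems(2)[of \<omega>] by (cases "Y \<omega>") auto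
  show ?case
  proof (cases j)
    case 0
    have "(\<lambda>\<omega>. if norm (Z \<omega>) \<le> norm (Y \<omega> ! 0) then Z \<omega> else Y \<omega> ! 0) \<in> borel_measurable M" by measurable
    moreover have "insort_key norm (Z \<omega>) (Y \<omega>) ! j = (if norm (Z \<omega>) \<le> norm (Y \<omega> ! 0) then Z \<omega> else Y \<omega> ! 0)" for \<omega>
      by (simp add: ins 0)
    ultimately show ?thesis by simp
  next
    case (Suc j')
    have Yj [measurable]: "(\<lambda>\<omega>. Y \<omega> ! j') \<in> borel_measurable M" using Suc.prems(1)[of j'] Suc.prems(3) Suc by simp
    have [measurable]: "(\<lambda>\<omega>. insort_key norm (Z \<omega>) (tl (Y \<omega>)) ! j') \<in> borel_measurable M"
    proof (rule Suc.IH)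
      show "(\<lambda>\<omega>. tl (Y \<omega>) ! i) \<in> borel_measurable M" if "i < m" for i
        using Suc.prems(1)[of "Suc i"] Suc.prems(2) that by (simp add: nth_tl)
    qed (use Suc.prems Suc in auto)
    have "(\<lambda>\<omega>. if norm (Z \<omega>) \<le> norm (Y \<omega> ! 0) then Y \<omega> ! j' else insort_key norm (Z \<omega>) (tl (Y \<omega>)) ! j')
      \<in> borel_measurable M" by measurable
    moreover have "insort_key norm (Z \<omega>) (Y \<omega>) ! j =
        (if norm (Z \<omega>) \<le> norm (Y \<omega> ! 0) then Y \<omega> ! j' else insort_key norm (Z \<omega>) (tl (Y \<omega>)) ! j')" for \<omega>
      by (simp add: ins Suc)
    ultimately show ?thesis by simp
  qed
qed

lemma measurable_sort_nth:
  fixes X :: "nat \<Rightarrow> 'w \<Rightarrow> 'b::{real_normed_vector, second_countable_topology}"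
  assumes "\<And>i. i \<in> set js \<Longrightarrow> X i \<in> borel_measurable M" "j < length js"
  shows "(\<lambda>\<omega>. sort_key norm (map (\<lambda>i. X i \<omega>) js) ! j) \<in> borel_measurable M"
  using assms
proof (induction js arbitrary: j)
  case (Cons i js)
  have "(\<lambda>\<omega>. insort_key norm (X i \<omega>) (sort_key norm (map (\<lambda>i. X i \<omega>) js)) ! j) \<in> borel_measurable M"
    by (rule measurable_insort_nth[where m = "length js"]) (use Cons in auto)
  then show ?case by (simp add: sort_key_simps)
qed simp

context uniform_sample
begin

abbreviation sample :: "'w \<Rightarrow> (real ^ 'd) list" where
  "sample \<equiv> sorted_sample n X"

lemma sample_nth_measurable [measurable]: "i < n \<Longrightarrow> (\<lambda>\<omega>. sample \<omega> ! i) \<in> borel_measurable M"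
  unfolding sorted_sample_def by (rule measurable_sort_nth) auto

lemma entrance_time_measurable:
  assumes "\<sigma> \<noteq> {}" "\<sigma> \<subseteq> {..<n}"
  shows "(\<lambda>\<omega>. entrance_time (sample \<omega>) \<sigma>) \<in> borel_measurable M"
  unfolding borel_measurable_iff_le
proof
  fix r
  have fin: "finite \<sigma>" using assms(2) finite_subset by blast
  have *: "(entrance_time (sample \<omega>) \<sigma> \<le> r) = (\<forall>i\<in>\<sigma>. \<forall>j\<in>\<sigma>. dist (sample \<omega> ! i) (sample \<omega> ! j) \<le> r)" for \<omega>
    using assms by (intro entrance_time_le_iff) auto
  have "{\<omega> \<in> space M. dist (sample \<omega> ! i) (sample \<omega> ! j) \<le> r} \<in> sets M" if "i \<in> \<sigma>" "j \<in> \<sigma>" for i j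
  proof -
    have "i < n" "j < n" using that assms(2) by auto
    then show ?thesis by measurable
  qed
  then show "{\<omega> \<in> space M. entrance_time (sample \<omega>) \<sigma> \<le> r} \<in> sets M"
    unfolding * by (intro sets.sets_Collect_finite_All fin)
qed

text \<open>The boundary matrix depends on the sample only through the orders of the simplices, which
  take finitely many values.\<close>

lemma ordered_simplices_event:
  "{\<omega> \<in> space M. ordered_simplices (sample \<omega>) m = ss} \<in> sets M"
proof -
  define V where "V = {\<sigma>. \<sigma> \<subseteq> {..<n} \<and> card \<sigma> = Suc m}"
  have V: "vr_simplices (sample \<omega>) m = V" for \<omega> by (simp add: vr_simplices_eq V_def)
  have iff: "ordered_simplices (sample \<omega>) m = ss \<longleftrightarrow> set ss = V \<and> sorted_wrt (rho_lex_less (sample \<omega>)) ss" for \<omega>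
    using ordered_simplices[of "sample \<omega>" m] V
      sorted_wrt_unique[of "rho_lex_less (sample \<omega>)" "ordered_simplices (sample \<omega>) m" ss]
      rho_lex_less_irrefl rho_lex_less_trans by metis
  show ?thesis
  proof (cases "set ss = V")
    case False
    then show ?thesis unfolding iff by simp
  next
    case True
    have [measurable]: "Measurable.pred M (\<lambda>\<omega>. rho_lex_less (sample \<omega>) \<sigma> \<tau>)" if "\<sigma> \<in> V" "\<tau> \<in> V" for \<sigma> \<tau>
    proof -
      have "(\<lambda>\<omega>. entrance_time (sample \<omega>) \<sigma>) \<in> borel_measurable M" "(\<lambda>\<omega>. entrance_time (sample \<omega>) \<tau>) \<in> borel_measurable M"
        using that by (auto simp: V_def intro!: entrance_time_measurable)
      note [measurable] = this
      show ?thesis unfolding rho_lex_less_def by measurable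
    qed
    have "{\<omega> \<in> space M. ordered_simplices (sample \<omega>) m = ss}
        = {\<omega> \<in> space M. \<forall>j\<in>{..<length ss}. \<forall>i\<in>{..<j}. rho_lex_less (sample \<omega>) (ss ! i) (ss ! j)}"
      using True by (auto simp: iff sorted_wrt_iff_nth_less)
    also have "\<dots> \<in> sets M"
    proof (intro sets.sets_Collect_finite_All)
      fix j i assume "j \<in> {..<length ss}" "i \<in> {..<j}"
      then have "ss ! i \<in> V" "ss ! j \<in> V" using True nth_mem by fastforce+
      then show "{\<omega> \<in> space M. rho_lex_less (sample \<omega>) (ss ! i) (ss ! j)} \<in> sets M" by measurable
    qed auto
    finally show ?thesis .
  qed
qed

lemma boundary_matrix_measurable:
  fixes g :: "bit mat \<Rightarrow> real"
  shows "(\<lambda>\<omega>. g (vr_boundary_matrix (sample \<omega>) k)) \<in> borel_measurable M"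
proof -
  define F where "F m = {ss :: nat set list. set ss \<subseteq> Pow {..<n} \<and> length ss \<le> n ^ Suc m}" for m
  have finF: "finite (F m)" for m unfolding F_def by (rule finite_lists_length_le) simp
  define h where "h \<omega> = (ordered_simplices (sample \<omega>) k, ordered_simplices (sample \<omega>) (Suc k))" for \<omega>
  define B where "B = (\<lambda>(rows, columns). mat (length rows) (length columns)
     (\<lambda>(r, c). if rows ! r \<subseteq> (columns ! c :: nat set) then 1 else 0 :: bit) :: bit mat)"
  have inF: "ordered_simplices (sample \<omega>) m \<in> F m" for m \<omega>
    using card_vr_simplices_le[of "sample \<omega>" m]
    by (auto simp: F_def ordered_simplices(1) length_ordered_simplices vr_simplices_eq)
  have "h \<in> measurable M (count_space (F k \<times> F (Suc k)))"
  proof (subst measurable_count_space_eq2)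
    show "finite (F k \<times> F (Suc k))" using finF by simp
    have "h -` {(a, b)} \<inter> space M \<in> sets M" for a b
    proof -
      have "h -` {(a, b)} \<inter> space M = {\<omega> \<in> space M. ordered_simplices (sample \<omega>) k = a}
          \<inter> {\<omega> \<in> space M. ordered_simplices (sample \<omega>) (Suc k) = b}"
        by (auto simp: h_def)
      also have "\<dots> \<in> sets M" using ordered_simplices_event by (intro sets.Int)
      finally show ?thesis .
    qed
    then show "h \<in> space M \<rightarrow> F k \<times> F (Suc k) \<and> (\<forall>a\<in>F k \<times> F (Suc k). h -` {a} \<inter> space M \<in> sets M)"
      using inF by (auto simp: h_def)
  qed
  then have "(\<lambda>\<omega>. g (B (h \<omega>))) \<in> borel_measurable M"
    by (rule measurable_compose) simp
  then show ?thesis by (simp add: B_def h_def vr_boundary_matrix_def Let_def)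
qed

lemma vr_fill_in_measurable [measurable]: "vr_fill_in k n X \<in> borel_measurable M"
  using boundary_matrix_measurable[of "\<lambda>D. real (mat_size (reduced_matrix D))" k]
  by (simp add: vr_fill_in_def[abs_def])

lemma vr_cost_measurable [measurable]: "vr_cost k n X \<in> borel_measurable M"
  using boundary_matrix_measurable[of "\<lambda>D. real (reduction_cost D)" k]
  by (simp add: vr_cost_def[abs_def])

lemma vr_fill_in_bounds: "0 \<le> vr_fill_in k n X \<omega>" "vr_fill_in k n X \<omega> \<le> real n ^ (2 * k + 2)"
proof -
  have "real (mat_size (reduced_matrix (vr_boundary_matrix (sample \<omega>) k))) \<le> real (n ^ (2 * k + 2))"
    using fill_in_trivial_bound[of "sample \<omega>" k] unfolding length_sorted_sample of_nat_le_iff .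
  then show "0 \<le> vr_fill_in k n X \<omega>" "vr_fill_in k n X \<omega> \<le> real n ^ (2 * k + 2)"
    by (simp_all add: vr_fill_in_def)
qed

lemma vr_cost_bounds: "0 \<le> vr_cost k n X \<omega>" "vr_cost k n X \<omega> \<le> real n ^ (k + 2) * vr_fill_in k n X \<omega>"
proof -
  have "real (reduction_cost (vr_boundary_matrix (sample \<omega>) k))
      \<le> real (n ^ (k + 2) * mat_size (reduced_matrix (vr_boundary_matrix (sample \<omega>) k)))"
    using cost_le_fill_in[of "sample \<omega>" k] unfolding length_sorted_sample of_nat_le_iff .
  then show "0 \<le> vr_cost k n X \<omega>" "vr_cost k n X \<omega> \<le> real n ^ (k + 2) * vr_fill_in k n X \<omega>"
    by (simp_all add: vr_cost_def vr_fill_in_def)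
qed

lemma integrable_vr_fill_in: "integrable M (vr_fill_in k n X)"
proof (rule integrable_const_bound)
  show "AE \<omega> in M. norm (vr_fill_in k n X \<omega>) \<le> real n ^ (2 * k + 2)"
    using vr_fill_in_bounds[of k] by (intro AE_I2) (simp only: real_norm_def abs_of_nonneg)
qed simp

lemma integrable_vr_cost: "integrable M (vr_cost k n X)"
proof (rule Bochner_Integration.integrable_bound)
  show "integrable M (\<lambda>\<omega>. real n ^ (k + 2) * vr_fill_in k n X \<omega>)"
    using integrable_vr_fill_in by simp
  show "AE \<omega> in M. norm (vr_cost k n X \<omega>) \<le> norm (real n ^ (k + 2) * vr_fill_in k n X \<omega>)"
  proof (rule AE_I2)
    fix \<omega>
    show "norm (vr_cost k n X \<omega>) \<le> norm (real n ^ (k + 2) * vr_fill_in k n X \<omega>)"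
      using vr_cost_bounds[of k \<omega>] unfolding real_norm_def by linarith
  qed
qed simp

lemma expectation_cost_le:
  "expectation (vr_cost k n X) \<le> real n ^ (k + 2) * expectation (vr_fill_in k n X)"
proof -
  have "expectation (vr_cost k n X) \<le> expectation (\<lambda>\<omega>. real n ^ (k + 2) * vr_fill_in k n X \<omega>)"
    using integrable_vr_fill_in integrable_vr_cost vr_cost_bounds by (intro integral_mono) auto
  then show ?thesis by simp
qed

section \<open>The expected fill-in\<close>

text \<open>Outside an event of small probability every grid cell contains a point and no enlarged cell
  contains many.\<close>

lemma expectation_fill_in_le:
  assumes k: "k \<ge> 1" and N: "N > 0"
  shows "expectation (vr_fill_in k n X) \<le> real (k + 2) * real n ^ Suc k + (real n * real K ^ k)\<^sup>2 +
    real n ^ (2 * k + 2) * (real N ^ CARD('d) *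
      (exp (- (real n / real N ^ CARD('d))) +
       exp (real n * ((1 + 60 * real CARD('d)) / real N) ^ CARD('d)) / 2 ^ K))"
proof -
  define C where "C = {c :: 'd \<Rightarrow> nat. \<forall>i. c i < N}"
  define G where "G = real (k + 2) * real n ^ Suc k + (real n * real K ^ k)\<^sup>2"
  define Miss where "Miss c = {\<omega> \<in> space M. \<forall>i<n. X i \<omega> \<notin> grid_cell N 0 c}" for c
  define Many where "Many c = {\<omega> \<in> space M. K \<le> card {i. i < n \<and> X i \<omega> \<in> grid_cell N (30 * real CARD('d)) c}}" for c
  define Bad where "Bad = (\<Union>c\<in>C. Miss c \<union> Many c)"
  have finC: "finite C" and cardC: "card C = N ^ CARD('d)" using grid_indices unfolding C_def by auto
  have Miss [measurable]: "Miss c \<in> sets M" for c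
  proof -
    have "Miss c = {\<omega> \<in> space M. \<forall>i\<in>{..<n}. X i \<omega> \<notin> grid_cell N 0 c}" by (auto simp: Miss_def)
    also have "\<dots> \<in> sets M" by (intro sets.sets_Collect_finite_All) auto
    finally show ?thesis .
  qed
  have Many [measurable]: "Many c \<in> sets M" for c
  proof -
    have "card {i. i < n \<and> X i \<omega> \<in> A} = (\<Sum>i<n. indicator A (X i \<omega>) :: real)" for \<omega> and A :: "(real ^ 'd) set"
      by (simp add: indicator_def sum.If_cases Int_def)
    then have "Many c = {\<omega> \<in> space M. real K \<le> (\<Sum>i<n. indicator (grid_cell N (30 * real CARD('d)) c) (X i \<omega>))}"
      by (simp add: Many_def flip: of_nat_le_iff[where 'a = real])
    also have "\<dots> \<in> sets M" by measurable
    finally show ?thesis .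
  qed
  have Bad [measurable]: "Bad \<in> sets M" unfolding Bad_def using finC by (intro sets.finite_UN) auto
  have "prob Bad \<le> (\<Sum>c\<in>C. prob (Miss c \<union> Many c))"
    unfolding Bad_def using finC by (intro measure_UNION_le) auto
  also have "\<dots> \<le> (\<Sum>c\<in>C. exp (- (real n / real N ^ CARD('d))) +
       exp (real n * ((1 + 60 * real CARD('d)) / real N) ^ CARD('d)) / 2 ^ K)"
  proof (rule sum_mono)
    fix c assume c: "c \<in> C"
    have "prob (Miss c) \<le> exp (- (real n * (1 / real N) ^ CARD('d)))"
      unfolding Miss_def using c by (intro prob_all_miss measure_grid_cell) (auto simp: C_def)
    moreover have "prob (Many c) \<le> exp (real n * ((1 + 2 * (30 * real CARD('d))) / real N) ^ CARD('d)) / 2 ^ K"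
      unfolding Many_def by (intro prob_many_hits measure_grid_cell_le) auto
    moreover have "prob (Miss c \<union> Many c) \<le> prob (Miss c) + prob (Many c)" by (intro measure_Un_le) auto
    ultimately show "prob (Miss c \<union> Many c) \<le> exp (- (real n / real N ^ CARD('d))) +
       exp (real n * ((1 + 60 * real CARD('d)) / real N) ^ CARD('d)) / 2 ^ K"
      by (simp add: power_one_over)
  qed
  finally have probBad: "prob Bad \<le> real N ^ CARD('d) * (exp (- (real n / real N ^ CARD('d))) +
       exp (real n * ((1 + 60 * real CARD('d)) / real N) ^ CARD('d)) / 2 ^ K)"
    by (simp add: cardC)
  have "AE \<omega> in M. vr_fill_in k n X \<omega> \<le> G + real n ^ (2 * k + 2) * indicator Bad \<omega>"
    using AE_in_unit_cube AE_distinct_distances AE_space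
  proof eventually_elim
    fix \<omega> assume cube: "\<forall>i<n. X i \<omega> \<in> unit_cube" and sp: "\<omega> \<in> space M"
      and dd: "\<forall>i j k l. i < n \<longrightarrow> j < n \<longrightarrow> k < n \<longrightarrow> l < n \<longrightarrow> i \<noteq> j \<longrightarrow> k \<noteq> l \<longrightarrow>
        dist (X i \<omega>) (X j \<omega>) = dist (X k \<omega>) (X l \<omega>) \<longrightarrow> {i, j} = {k, l}"
    have G0: "0 \<le> G" by (simp add: G_def)
    show "vr_fill_in k n X \<omega> \<le> G + real n ^ (2 * k + 2) * indicator Bad \<omega>"
    proof (cases "\<omega> \<in> Bad")
      case True
      then show ?thesis using vr_fill_in_bounds(2)[of k \<omega>] G0 by simp
    next
      case False
      have "mat_size (reduced_matrix (vr_boundary_matrix (sample \<omega>) k))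
        \<le> (k + 2) * length (sample \<omega>) ^ Suc k + (length (sample \<omega>) * K ^ k)\<^sup>2"
      proof (rule fill_in_evenly_spread[OF k N])
        show "distinct_distances (sample \<omega>)"
          using dd by (intro distinct_distances_sorted_sample) blast
        show "set (sample \<omega>) \<subseteq> unit_cube" using cube by (auto simp: set_sorted_sample)
        fix c :: "'d \<Rightarrow> nat" assume "\<And>i. c i < N"
        then have "\<omega> \<notin> Miss c" "\<omega> \<notin> Many c" using False by (auto simp: Bad_def C_def)
        then show "\<exists>p\<in>set (sample \<omega>). p \<in> grid_cell N 0 c"
          "card {i. i < length (sample \<omega>) \<and> sample \<omega> ! i \<in> grid_cell N (30 * real CARD('d)) c} \<le> K"
          using sp by (auto simp: Miss_def Many_def set_sorted_sample card_sorted_sample_in)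
      qed (use norm_sorted_sample_mono in auto)
      then have "vr_fill_in k n X \<omega> \<le> real ((k + 2) * n ^ Suc k + (n * K ^ k)\<^sup>2)"
        unfolding vr_fill_in_def length_sorted_sample of_nat_le_iff .
      also have "\<dots> = G" by (simp add: G_def algebra_simps)
      finally show ?thesis using False by simp
    qed
  qed
  then have "expectation (vr_fill_in k n X) \<le> expectation (\<lambda>\<omega>. G + real n ^ (2 * k + 2) * indicator Bad \<omega>)"
  proof (rule integral_mono_AE[OF integrable_vr_fill_in, rotated])
    have "integrable M (indicator Bad :: _ \<Rightarrow> real)" by (simp add: emeasure_eq_measure)
    then show "integrable M (\<lambda>\<omega>. G + real n ^ (2 * k + 2) * indicator Bad \<omega>)"
      by (intro Bochner_Integration.integrable_add integrable_mult_right integrable_const)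
  qed
  also have "\<dots> = G + real n ^ (2 * k + 2) * prob Bad"
    by (subst Bochner_Integration.integral_add) (simp_all add: prob_space emeasure_eq_measure)
  also have "\<dots> \<le> G + real n ^ (2 * k + 2) * (real N ^ CARD('d) * (exp (- (real n / real N ^ CARD('d))) +
       exp (real n * ((1 + 60 * real CARD('d)) / real N) ^ CARD('d)) / 2 ^ K))"
    using probBad by (intro add_left_mono mult_left_mono) auto
  finally show ?thesis by (simp add: G_def)
qed

end

text \<open>The number \<open>N ^ d\<close> of cells is chosen such that a cell contains on average at least
  \<open>c * ln n\<close> points, where \<open>c = 2 * k + 3\<close>, but not more than a constant multiple of it. Each of the
  exceptional events then has probability at most \<open>n powr (- c)\<close>. There are \<open>2 * N ^ d\<close>, hence
  at most \<open>2 * n\<close>, such events, and \<open>c\<close> is just large enough to outweigh this number times the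
  trivial bound \<open>n ^ (2 * k + 2)\<close> on the fill-in.\<close>

lemma grid_parameters:
  fixes d k :: nat
  defines "c \<equiv> real (2 * k + 3)" and "A \<equiv> (2 + 120 * real d) ^ d"
  assumes d: "d > 0" and L: "ln (real n) \<ge> 1" and n: "c * ln (real n) \<le> real n"
  obtains N K :: nat where "N > 0" "real K \<le> (2 * (A + 1) * c + 1) * ln (real n)"
    "real N ^ d * (exp (- (real n / real N ^ d)) +
       exp (real n * ((1 + 60 * real d) / real N) ^ d) / 2 ^ K) * real n ^ (2 * k + 2) \<le> 2"
proof -
  define l where "l = c * ln (real n)"
  have n0: "real n > 0" using L by (cases "n = 0") auto
  have c1: "c \<ge> 1" by (simp add: c_def)
  have l1: "l \<ge> 1" using mult_mono[OF c1 L] c1 by (simp add: l_def)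
  have ln: "l \<le> real n" using n by (simp add: l_def)
  have A0: "A \<ge> 0" by (simp add: A_def)
  define x where "x = root d (real n / l)"
  have x1: "x \<ge> 1" using ln l1 d by (simp add: x_def)
  have xd: "x ^ d = real n / l" using d l1 n0 by (simp add: x_def)
  define N where "N = nat \<lfloor>x\<rfloor>"
  have N: "N > 0" "real N \<le> x" "x / 2 \<le> real N"
  proof -
    have f: "1 \<le> \<lfloor>x\<rfloor>" "real_of_int \<lfloor>x\<rfloor> \<le> x" "x < real_of_int \<lfloor>x\<rfloor> + 1"
      using x1 by (simp_all add: le_floor_iff)
    have NR: "real N = real_of_int \<lfloor>x\<rfloor>" using f(1) by (simp add: N_def)
    have one: "1 \<le> real_of_int \<lfloor>x\<rfloor>" using f(1) by linarith
    show "N > 0" using f(1) by (simp add: N_def)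
    show "real N \<le> x" using f(2) NR by simp
    show "x / 2 \<le> real N" using one f(3) NR by linarith
  qed
  have Nd: "real N ^ d \<le> real n / l" using power_mono[OF N(2), of d] by (simp add: xd)
  have Nd0: "real N ^ d > 0" using N(1) by simp
  have lower: "l \<le> real n / real N ^ d" using Nd Nd0 l1 by (simp add: field_simps)
  have upper: "real n * ((1 + 60 * real d) / real N) ^ d \<le> A * l"
  proof -
    have "(x / 2) ^ d \<le> real N ^ d" using N(3) x1 by (intro power_mono) auto
    then have "real n / l / 2 ^ d \<le> real N ^ d" by (simp add: power_divide xd)
    then have "real n / real N ^ d \<le> 2 ^ d * l" using Nd0 l1 by (simp add: field_simps)
    then have "(1 + 60 * real d) ^ d * (real n / real N ^ d) \<le> (1 + 60 * real d) ^ d * (2 ^ d * l)"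
      by (intro mult_left_mono) auto
    also have "\<dots> = A * l" by (simp add: A_def flip: power_mult_distrib)
    finally show ?thesis by (simp add: power_divide mult.commute)
  qed
  define K where "K = nat \<lceil>2 * (A + 1) * l\<rceil>"
  have K0: "0 \<le> 2 * (A + 1) * l" using A0 l1 by simp
  have K: "2 * (A + 1) * l \<le> real K" "real K \<le> 2 * (A + 1) * l + 1"
    using K0 by (auto simp: K_def)
  have "exp (A * l) / 2 ^ K \<le> exp (- l)"
  proof -
    have "ln 2 \<ge> (1 / 2 :: real)" using ln2_ge_two_thirds by simp
    then have "(A + 1) * l \<le> real K * ln 2"
      using K(1) mult_left_mono[of "1 / 2" "ln 2" "real K"] by (simp add: algebra_simps)
    then have "exp ((A + 1) * l) \<le> 2 ^ K"
      by (metis exp_ln exp_of_nat_mult exp_le_cancel_iff zero_less_numeral)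
    then have "exp (A * l) * exp l \<le> 2 ^ K" by (simp add: distrib_right exp_add)
    then show ?thesis by (simp add: exp_minus field_simps)
  qed
  moreover have "exp (real n * ((1 + 60 * real d) / real N) ^ d) / 2 ^ K \<le> exp (A * l) / 2 ^ K"
    using upper by (intro divide_right_mono) auto
  moreover have "exp (- (real n / real N ^ d)) \<le> exp (- l)" using lower by simp
  ultimately have "exp (- (real n / real N ^ d)) +
       exp (real n * ((1 + 60 * real d) / real N) ^ d) / 2 ^ K \<le> 2 * exp (- l)" by linarith
  moreover have "real N ^ d \<le> real n"
  proof -
    have "real n / l \<le> real n / 1" using l1 n0 by (intro divide_left_mono) auto
    then show ?thesis using Nd by linarith
  qed
  ultimately have "real N ^ d * (exp (- (real n / real N ^ d)) +
       exp (real n * ((1 + 60 * real d) / real N) ^ d) / 2 ^ K) \<le> real n * (2 * exp (- l))"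
    by (intro mult_mono) auto
  then have "real N ^ d * (exp (- (real n / real N ^ d)) +
       exp (real n * ((1 + 60 * real d) / real N) ^ d) / 2 ^ K) * real n ^ (2 * k + 2)
     \<le> real n * (2 * exp (- l)) * real n ^ (2 * k + 2)"
    by (intro mult_right_mono) auto
  also have "\<dots> = 2 * (real n ^ (2 * k + 3) * exp (- l))"
    by (simp add: power_add numeral_eq_Suc)
  also have "real n ^ (2 * k + 3) = exp l"
    unfolding l_def c_def using n0 by (simp only: exp_of_nat_mult exp_ln)
  also have "2 * (exp l * exp (- l)) = 2" by (simp add: exp_minus)
  finally have prob: "real N ^ d * (exp (- (real n / real N ^ d)) +
       exp (real n * ((1 + 60 * real d) / real N) ^ d) / 2 ^ K) * real n ^ (2 * k + 2) \<le> 2" .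
  have "real K \<le> (2 * (A + 1) * c + 1) * ln (real n)"
    using K(2) L by (simp add: l_def algebra_simps)
  then show ?thesis using that N(1) prob by blast
qed

lemma eventually_mult_ln_le: "eventually (\<lambda>n. c * ln (real n) \<le> real n) sequentially"
proof -
  have "((\<lambda>n. c * (ln (real n) / real n)) \<longlongrightarrow> c * 0) sequentially"
    by (intro tendsto_mult tendsto_const lim_ln_over_n)
  then have "eventually (\<lambda>n. c * (ln (real n) / real n) < 1) sequentially"
    by (rule order_tendstoD) simp
  then show ?thesis
    using eventually_gt_at_top[of 0] by eventually_elim (simp add: field_simps)
qed

theorem theorem2:
  fixes k :: nat
    and M :: "nat \<Rightarrow> 'w measure"
    and X :: "nat \<Rightarrow> nat \<Rightarrow> 'w \<Rightarrow> real ^ 'd"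
  assumes "k \<ge> 1"
    and "\<And>n. iid_uniform_cube (M n) n (X n)"
  shows "(\<forall>n. integrable (M n) (vr_fill_in k n (X n)))
    \<and> (\<forall>n. integrable (M n) (vr_cost k n (X n)))
    \<and> (\<lambda>n. prob_space.expectation (M n) (vr_fill_in k n (X n)))
           \<in> O(\<lambda>n. real n ^ 2 * ln (real n) ^ (2 * k) + real n ^ (k + 1))
    \<and> (\<lambda>n. prob_space.expectation (M n) (vr_cost k n (X n)))
           \<in> O(\<lambda>n. real n ^ (k + 4) * ln (real n) ^ (2 * k) + real n ^ (2 * k + 3))"
proof -
  have us: "uniform_sample (M n) n (X n)" for n
    using assms(2)[of n] by (simp add: uniform_sample_def uniform_sample_axioms_def iid_uniform_cube_def)
  define g where "g n = real n ^ 2 * ln (real n) ^ (2 * k) + real n ^ (k + 1)" for n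
  define c where "c = real (2 * k + 3)"
  define B where "B = 2 * ((2 + 120 * real CARD('d)) ^ CARD('d) + 1) * c + 1"
  define C where "C = real (k + 4) + B ^ (2 * k)"
  have g0: "g n \<ge> 0" for n
    by (simp add: g_def power_mult)
  have fill: "eventually (\<lambda>n. prob_space.expectation (M n) (vr_fill_in k n (X n)) \<le> C * g n) sequentially"
    using eventually_mult_ln_le[of c] eventually_ge_at_top[of 3]
  proof eventually_elim
    fix n :: nat assume n: "c * ln (real n) \<le> real n" "3 \<le> n"
    interpret uniform_sample "M n" n "X n" by (rule us)
    define L where "L = ln (real n)"
    have L1: "1 \<le> L"
    proof -
      have "exp 1 \<le> (3 :: real)" by (rule exp_le)
      also have "\<dots> \<le> real n" using n(2) by simp
      finally show ?thesis using n(2) by (simp add: L_def ln_ge_iff)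
    qed
    have "(2 + 120 * real CARD('d)) ^ CARD('d) + 1 \<ge> (0 :: real)" by simp
    then have B0: "B \<ge> 0" by (simp add: B_def c_def)
    obtain N K :: nat where NK: "N > 0" "real K \<le> B * L"
      "real N ^ CARD('d) * (exp (- (real n / real N ^ CARD('d))) +
       exp (real n * ((1 + 60 * real CARD('d)) / real N) ^ CARD('d)) / 2 ^ K) * real n ^ (2 * k + 2) \<le> 2"
      using grid_parameters[of "CARD('d)" n k] L1 n(1) unfolding L_def B_def c_def by auto
    have "expectation (vr_fill_in k n (X n)) \<le> real (k + 2) * real n ^ Suc k + (real n * real K ^ k)\<^sup>2 + 2"
      using expectation_fill_in_le[OF assms(1) NK(1), of K] NK(3) by (simp only: mult.commute)
    also have "(real n * real K ^ k)\<^sup>2 \<le> (real n * (B * L) ^ k)\<^sup>2"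
      using NK(2) by (intro power_mono mult_left_mono) auto
    also have "(real n * (B * L) ^ k)\<^sup>2 = B ^ (2 * k) * (real n ^ 2 * L ^ (2 * k))"
      by (simp add: power_mult_distrib power_mult[symmetric] mult.commute)
    also have "(2 :: real) \<le> 2 * real n ^ Suc k"
      using n(2) one_le_power[of "real n" "Suc k"] by simp
    also have "real (k + 2) * real n ^ Suc k + B ^ (2 * k) * (real n ^ 2 * L ^ (2 * k)) + 2 * real n ^ Suc k
        \<le> C * g n"
    proof -
      define P where "P = real n ^ Suc k"
      define Q where "Q = real n ^ 2 * L ^ (2 * k)"
      have "0 \<le> B ^ (2 * k) * P" "0 \<le> real (k + 4) * Q"
        using B0 L1 by (auto simp: P_def Q_def)
      moreover have "C * g n = (real (k + 4) + B ^ (2 * k)) * (Q + P)"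
        by (simp add: C_def g_def P_def Q_def L_def)
      ultimately have "real (k + 2) * P + B ^ (2 * k) * Q + 2 * P \<le> C * g n"
        by (simp add: algebra_simps)
      then show ?thesis by (simp add: P_def Q_def)
    qed
    finally show "expectation (vr_fill_in k n (X n)) \<le> C * g n" by simp
  qed
  have fill0: "0 \<le> prob_space.expectation (M n) (vr_fill_in k n (X n))" for n
    using uniform_sample.vr_fill_in_bounds(1)[OF us] by (intro integral_nonneg_AE AE_I2)
  have cost0: "0 \<le> prob_space.expectation (M n) (vr_cost k n (X n))" for n
    using uniform_sample.vr_cost_bounds(1)[OF us] by (intro integral_nonneg_AE AE_I2)
  have fill_O: "(\<lambda>n. prob_space.expectation (M n) (vr_fill_in k n (X n))) \<in> O(g)"
    using fill by (intro bigoI[of _ C]) (auto simp: fill0 g0 elim!: eventually_mono)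
  have "eventually (\<lambda>n. prob_space.expectation (M n) (vr_cost k n (X n)) \<le> C * (real n ^ (k + 2) * g n)) sequentially"
    using fill
  proof eventually_elim
    fix n assume "prob_space.expectation (M n) (vr_fill_in k n (X n)) \<le> C * g n"
    then have "real n ^ (k + 2) * prob_space.expectation (M n) (vr_fill_in k n (X n)) \<le> real n ^ (k + 2) * (C * g n)"
      by (intro mult_left_mono) auto
    then show "prob_space.expectation (M n) (vr_cost k n (X n)) \<le> C * (real n ^ (k + 2) * g n)"
      using uniform_sample.expectation_cost_le[OF us, of n k] by (simp add: mult.left_commute)
  qed
  then have "(\<lambda>n. prob_space.expectation (M n) (vr_cost k n (X n))) \<in> O(\<lambda>n. real n ^ (k + 2) * g n)"
    by (intro bigoI[of _ C]) (auto simp: cost0 g0 elim!: eventually_mono)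
  also have "(\<lambda>n. real n ^ (k + 2) * g n) =
      (\<lambda>n. real n ^ (k + 4) * ln (real n) ^ (2 * k) + real n ^ (2 * k + 3))"
    by (rule ext) (simp add: g_def distrib_left power_add power2_eq_square numeral_eq_Suc mult_2)
  finally show ?thesis
    using fill_O uniform_sample.integrable_vr_fill_in[OF us] uniform_sample.integrable_vr_cost[OF us]
    unfolding g_def by blast
qed

end
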